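(* Let $(E,\|\cdot\|)$ be an $RN$ module with base $(\Omega,\mathcal F,P)$ and let $G$ be a random sequentially compact $L^0$-convex subset of $E$. Then every $\sigma$-stable and random sequentially continuous mapping $T$ from $G$ to $G$ has a fixed point.
   Context: Notation. $(\Omega,\mathcal F,P)$ is a probability space, $\mathbb K$ is $\mathbb R$ or $\mathbb C$. $L^0(\mathcal F,\mathbb K)$ is the algebra of a.s.-equivalence classes of $\mathbb K$-valued $\mathcal F$-measurable random variables; $L^0(\mathcal F)=L^0(\mathcal F,\mathbb R)$, partially ordered by $\xi\le\eta$ iff $\xi(\omega)\le\eta(\omega)$ a.s. $L^0_+(\mathcal F)=\{\xi\in L^0(\mathcal F):\xi\ge 0\}$. $\tilde I_A$ is the equivalence class of the indicator function $I_A$ of $A\in\mathcal F$. $RN$ module. An $RN$ module $(E,\|\cdot\|)$ over $\mathbb K$ with base $(\Omega,\mathcal F,P)$ is a left module $E$ over the algebra $L^0(\mathcal F,\mathbb K)$ with a map $\|\cdot\|:E\to L^0_+(\mathcal F)$ such that $\|\xi x\|=|\xi|\,\|x\|$ for all $\xi\in L^0(\mathcal F,\mathbb K)$, $x\in E$; $\|x+y\|\le\|x\|+\|y\|$ for all $x,y\in E$; and $\|x\|=0$ implies $x=\theta$ (the null element). Topology. The $(\varepsilon,\lambda)$-topology $\mathcal T_{\varepsilon,\lambda}$ on $E$ is the metrizable linear topology with local base at $\theta$ given by the sets $\{x\in E: P\{\omega:\|x\|(\omega)<\varepsilon\}>1-\lambda\}$, $\varepsilon>0$, $0<\lambda<1$;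 so $x_n\to x$ in $\mathcal T_{\varepsilon,\lambda}$ iff $\|x_n-x\|\to 0$ in probability. $L^0$-convexity and $\sigma$-stability. A nonempty $G\subset E$ is $L^0$-convex if $\xi x+(1-\xi)y\in G$ for all $x,y\in G$ and $\xi\in L^0_+(\mathcal F)$ with $0\le\xi\le1$. A countable partition of $\Omega$ to $\mathcal F$ is a sequence $\{A_n,n\in\mathbb N\}$ of pairwise disjoint members of $\mathcal F$ with union $\Omega$. A nonempty $G\subset E$ is $\sigma$-stable if for every sequence $\{x_n\}$ in $G$ and every countable partition $\{A_n\}$ of $\Omega$ to $\mathcal F$ there is $x\in G$ with $\tilde I_{A_n}x=\tilde I_{A_n}x_n$ for all $n$; such $x$ is unique in an $RN$ module and is written $\sum_n\tilde I_{A_n}x_n$. Random sequential compactness. Let $G$ be a nonempty subset of $E$ contained in a $\sigma$-stable subset $H$ of $E$. A random subsequence of a sequence $\{x_n,n\in\mathbb N\}$ in $G$ is a sequence $\{y_k,k\in\mathbb N\}$ in $H$ for which there are positive-integer-valued random variables $n_k$ ($k\in\mathbb N$) on $(\Omega,\mathcal F,P)$ with $n_k(\omega)<n_{k+1}(\omega)$ for all $k\in\mathbb N$, $\omega\in\Omega$, and $y_k=x_{n_k}:=\sum_{l=1}^\infty\tilde I_{(n_k=l)}x_l$ for all $k$. $G$ is random sequentially compact if every sequence in $G$ has a random subsequence converging in $\mathcal T_{\varepsilon,\lambda}$ to some element of $G$. (A random sequentially compact $L^0$-convex set is always $\sigma$-stable, so the notions below make sense on it.) Mappings. For nonempty $G_1,G_2$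 in $RN$ modules over the same $\mathbb K$ with the same base, $T:G_1\to G_2$ is $\sigma$-stable if $G_1,G_2$ are $\sigma$-stable and $T(\sum_k\tilde I_{A_k}x_k)=\sum_k\tilde I_{A_k}T(x_k)$ for every countable partition $\{A_k\}$ of $\Omega$ to $\mathcal F$ and every sequence $\{x_k\}$ in $G_1$. $T$ is random sequentially continuous if $G_1$ is $\sigma$-stable and, for every $x_0\in G_1$ and every sequence $\{x_n\}$ in $G_1$ converging in $\mathcal T_{\varepsilon,\lambda}$ to $x_0$, there is a random subsequence $\{x_{n_k}\}$ of $\{x_n\}$ such that $\{T(x_{n_k})\}$ converges in $\mathcal T_{\varepsilon,\lambda}$ to $T(x_0)$. *)

theory Defs
  imports "HOL-Probability.Probability" "HOL-Algebra.Module"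
begin

text \<open>The scalar field: up to isomorphism of normed fields, this class contains exactly the
  reals and the complex numbers (the multiplicative norm of a \<^class>\<open>real_normed_field\<close> is
  determined on an algebraic extension of the reals).\<close>

class real_or_complex = real_normed_field + second_countable_topology +
  assumes real_or_complex:
    "(\<forall>x. \<exists>a. x = a *\<^sub>R 1) \<or>
     (\<exists>i. i * i = - 1 \<and> (\<forall>x. \<exists>a b. x = a *\<^sub>R 1 + b *\<^sub>R i))"

instance real :: real_or_complex
  by standard auto

instance complex :: real_or_complex
proof
  have "\<forall>x. \<exists>a b. x = a *\<^sub>R 1 + b *\<^sub>R \<i>"
    by (auto simp: complex_eq_iff)
  then show "(\<forall>x::complex. \<exists>a. x = a *\<^sub>R 1) \<or>
     (\<exists>i::complex. i * i = - 1 \<and> (\<forall>x. \<exists>a b. x = a *\<^sub>R 1 + b *\<^sub>R i))"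
    by (intro disjI2 exI[of _ \<i>]) simp
qed

text \<open>Elements of \<open>L\<^sup>0\<close> are genuine a.s.-equivalence classes, that is, sets of functions.\<close>

definition L0_class :: "'w measure \<Rightarrow> ('w \<Rightarrow> 'b::topological_space) \<Rightarrow> ('w \<Rightarrow> 'b) set" where
  "L0_class M f = {g \<in> borel_measurable M. AE \<omega> in M. g \<omega> = f \<omega>}"

definition L0_map ::
    "'w measure \<Rightarrow> ('a \<Rightarrow> 'b::topological_space) \<Rightarrow> ('w \<Rightarrow> 'a) set \<Rightarrow> ('w \<Rightarrow> 'b) set" where
  "L0_map M h X = (\<Union>f\<in>X. L0_class M (\<lambda>\<omega>. h (f \<omega>)))"

definition L0_map2 ::
    "'w measure \<Rightarrow> ('a \<Rightarrow> 'b \<Rightarrow> 'c::topological_space) \<Rightarrow>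
      ('w \<Rightarrow> 'a) set \<Rightarrow> ('w \<Rightarrow> 'b) set \<Rightarrow> ('w \<Rightarrow> 'c) set" where
  "L0_map2 M h X Y = (\<Union>f\<in>X. \<Union>g\<in>Y. L0_class M (\<lambda>\<omega>. h (f \<omega>) (g \<omega>)))"

definition L0 :: "'w measure \<Rightarrow> ('w \<Rightarrow> 'k::real_or_complex) set ring" where
  "L0 M = \<lparr>carrier = L0_class M ` borel_measurable M,
           mult = L0_map2 M (*),
           one = L0_class M (\<lambda>_. 1),
           zero = L0_class M (\<lambda>_. 0),
           add = L0_map2 M (+)\<rparr>"

definition L0_le :: "'w measure \<Rightarrow> ('w \<Rightarrow> real) set \<Rightarrow> ('w \<Rightarrow> real) set \<Rightarrow> bool" where
  "L0_le M \<xi> \<eta> \<longleftrightarrow> (\<exists>f\<in>\<xi>. \<exists>g\<in>\<eta>. AE \<omega> in M. f \<omega> \<le> g \<omega>)"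

definition L0_plus :: "'w measure \<Rightarrow> ('w \<Rightarrow> real) set set" where
  "L0_plus M = {\<xi> \<in> carrier (L0 M). L0_le M \<zero>\<^bsub>L0 M\<^esub> \<xi>}"

definition L0_abs ::
    "'w measure \<Rightarrow> ('w \<Rightarrow> 'k::real_or_complex) set \<Rightarrow> ('w \<Rightarrow> real) set" where
  "L0_abs M = L0_map M norm"

definition L0_of_real ::
    "'w measure \<Rightarrow> ('w \<Rightarrow> real) set \<Rightarrow> ('w \<Rightarrow> 'k::real_or_complex) set" where
  "L0_of_real M = L0_map M of_real"

definition L0_ind :: "'w measure \<Rightarrow> 'w set \<Rightarrow> ('w \<Rightarrow> 'k::real_or_complex) set" where
  "L0_ind M A = L0_class M (indicator A)"

lemma L0_class_self: "f \<in> borel_measurable M \<Longrightarrow> f \<in> L0_class M f"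
  by (simp add: L0_class_def)

lemma L0_class_eq_iff:
  assumes "f \<in> borel_measurable M"
  shows "L0_class M f = L0_class M g \<longleftrightarrow> (AE \<omega> in M. f \<omega> = g \<omega>)"
proof
  assume "L0_class M f = L0_class M g"
  with assms show "AE \<omega> in M. f \<omega> = g \<omega>"
    using L0_class_self by (auto simp: L0_class_def)
next
  assume *: "AE \<omega> in M. f \<omega> = g \<omega>"
  have "(AE \<omega> in M. h \<omega> = f \<omega>) \<longleftrightarrow> (AE \<omega> in M. h \<omega> = g \<omega>)" for h
  proof
    assume "AE \<omega> in M. h \<omega> = f \<omega>"
    with * show "AE \<omega> in M. h \<omega> = g \<omega>" by eventually_elim simp
  next
    assume "AE \<omega> in M. h \<omega> = g \<omega>"
    with * show "AE \<omega> in M. h \<omega> = f \<omega>" by eventually_elim simp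
  qed
  then show "L0_class M f = L0_class M g"
    by (simp add: L0_class_def)
qed

lemma L0_map_class:
  assumes "f \<in> borel_measurable M"
  shows "L0_map M h (L0_class M f) = L0_class M (\<lambda>\<omega>. h (f \<omega>))"
proof -
  have "g \<in> L0_class M (\<lambda>\<omega>. h (f \<omega>))"
    if "f' \<in> L0_class M f" "g \<in> L0_class M (\<lambda>\<omega>. h (f' \<omega>))" for g f'
  proof -
    have "AE \<omega> in M. f' \<omega> = f \<omega>" "AE \<omega> in M. g \<omega> = h (f' \<omega>)"
      using that by (auto simp: L0_class_def)
    then have "AE \<omega> in M. g \<omega> = h (f \<omega>)" by eventually_elim simp
    then show ?thesis using that by (simp add: L0_class_def)
  qed
  then show ?thesis
    unfolding L0_map_def using L0_class_self[OF assms] by blast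
qed

lemma L0_map2_class:
  assumes "f \<in> borel_measurable M" "g \<in> borel_measurable M"
  shows "L0_map2 M h (L0_class M f) (L0_class M g) = L0_class M (\<lambda>\<omega>. h (f \<omega>) (g \<omega>))"
proof -
  have "k \<in> L0_class M (\<lambda>\<omega>. h (f \<omega>) (g \<omega>))"
    if "f' \<in> L0_class M f" "g' \<in> L0_class M g" "k \<in> L0_class M (\<lambda>\<omega>. h (f' \<omega>) (g' \<omega>))" for k f' g'
  proof -
    have "AE \<omega> in M. f' \<omega> = f \<omega>" "AE \<omega> in M. g' \<omega> = g \<omega>" "AE \<omega> in M. k \<omega> = h (f' \<omega>) (g' \<omega>)"
      using that by (auto simp: L0_class_def)
    then have "AE \<omega> in M. k \<omega> = h (f \<omega>) (g \<omega>)" by eventually_elim simp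
    then show ?thesis using that by (simp add: L0_class_def)
  qed
  then show ?thesis
    unfolding L0_map2_def using L0_class_self[OF assms(1)] L0_class_self[OF assms(2)] by blast
qed

lemma L0_cring: "cring (L0 M :: ('w \<Rightarrow> 'k::real_or_complex) set ring)"
proof -
  have car: "\<exists>f. f \<in> borel_measurable M \<and> X = L0_class M f" if "X \<in> carrier (L0 M)" for X :: "('w \<Rightarrow> 'k) set"
    using that by (auto simp: L0_def)
  have inv: "\<exists>Y\<in>carrier (L0 M). Y \<oplus>\<^bsub>L0 M\<^esub> X = \<zero>\<^bsub>L0 M\<^esub>"
    if X: "X \<in> carrier (L0 M)" for X :: "('w \<Rightarrow> 'k) set"
  proof -
    obtain f where f: "f \<in> borel_measurable M" "X = L0_class M f"
      using car[OF X] by blast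
    have "L0_class M (\<lambda>\<omega>. - f \<omega>) \<in> carrier (L0 M)"
      "L0_class M (\<lambda>\<omega>. - f \<omega>) \<oplus>\<^bsub>L0 M\<^esub> X = \<zero>\<^bsub>L0 M\<^esub>"
      using f by (auto simp: L0_def L0_map2_class)
    then show ?thesis by blast
  qed
  have ag: "abelian_group (L0 M :: ('w \<Rightarrow> 'k) set ring)"
    by (rule abelian_groupI)
       (use inv in \<open>auto dest!: car simp: L0_map2_class algebra_simps\<close>,
        auto simp: L0_def L0_map2_class algebra_simps)
  have cm: "comm_monoid (L0 M :: ('w \<Rightarrow> 'k) set ring)"
    by (rule comm_monoidI) (auto simp: L0_def L0_map2_class algebra_simps)
  show ?thesis
    by (rule cringI[OF ag cm]) (auto simp: L0_def L0_map2_class algebra_simps)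
qed

locale RN_module = prob_space M + E: Module.module "L0 M" E
  for M :: "'w measure" and E :: "(('w \<Rightarrow> 'k::real_or_complex) set, 'e) module" +
  fixes nrm :: "'e \<Rightarrow> ('w \<Rightarrow> real) set"
  assumes nrm_closed: "nrm \<in> carrier E \<rightarrow> L0_plus M"
    and nrm_smult: "\<And>\<xi> x. \<lbrakk>\<xi> \<in> carrier (L0 M); x \<in> carrier E\<rbrakk> \<Longrightarrow>
          nrm (\<xi> \<odot>\<^bsub>E\<^esub> x) = L0_abs M \<xi> \<otimes>\<^bsub>L0 M\<^esub> nrm x"
    and nrm_triangle: "\<And>x y. \<lbrakk>x \<in> carrier E; y \<in> carrier E\<rbrakk> \<Longrightarrow>
          L0_le M (nrm (x \<oplus>\<^bsub>E\<^esub> y)) (nrm x \<oplus>\<^bsub>L0 M\<^esub> nrm y)"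
    and nrm_eq_zero: "\<And>x. \<lbrakk>x \<in> carrier E; nrm x = \<zero>\<^bsub>L0 M\<^esub>\<rbrakk> \<Longrightarrow> x = \<zero>\<^bsub>E\<^esub>"

text \<open>The local base at the null element. The existential over representatives is harmless, since
  the probability does not depend on the chosen representative of the class \<open>nrm x\<close>.\<close>

definition eps_lambda_nhd ::
    "'w measure \<Rightarrow> (('w \<Rightarrow> 'k::real_or_complex) set, 'e) module \<Rightarrow> ('e \<Rightarrow> ('w \<Rightarrow> real) set) \<Rightarrow>
      real \<Rightarrow> real \<Rightarrow> 'e set" where
  "eps_lambda_nhd M E nrm \<epsilon> \<delta> =
     {x \<in> carrier E. \<exists>f\<in>nrm x. measure M {\<omega> \<in> space M. f \<omega> < \<epsilon>} > 1 - \<delta>}"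

definition eps_lambda_open ::
    "'w measure \<Rightarrow> (('w \<Rightarrow> 'k::real_or_complex) set, 'e) module \<Rightarrow> ('e \<Rightarrow> ('w \<Rightarrow> real) set) \<Rightarrow>
      'e set \<Rightarrow> bool" where
  "eps_lambda_open M E nrm U \<longleftrightarrow> U \<subseteq> carrier E \<and>
     (\<forall>x\<in>U. \<exists>\<epsilon>>0. \<exists>\<delta>. 0 < \<delta> \<and> \<delta> < 1 \<and> (\<forall>v\<in>eps_lambda_nhd M E nrm \<epsilon> \<delta>. x \<oplus>\<^bsub>E\<^esub> v \<in> U))"

definition eps_lambda_topology ::
    "'w measure \<Rightarrow> (('w \<Rightarrow> 'k::real_or_complex) set, 'e) module \<Rightarrow> ('e \<Rightarrow> ('w \<Rightarrow> real) set) \<Rightarrow>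
      'e topology" where
  "eps_lambda_topology M E nrm = topology (eps_lambda_open M E nrm)"

lemma (in RN_module) eps_lambda_nhd_mono:
  assumes "\<epsilon> \<le> \<epsilon>'" "\<delta> \<le> \<delta>'"
  shows "eps_lambda_nhd M E nrm \<epsilon> \<delta> \<subseteq> eps_lambda_nhd M E nrm \<epsilon>' \<delta>'"
proof
  fix x assume "x \<in> eps_lambda_nhd M E nrm \<epsilon> \<delta>"
  then obtain f where x: "x \<in> carrier E" and f: "f \<in> nrm x"
    and p: "measure M {\<omega> \<in> space M. f \<omega> < \<epsilon>} > 1 - \<delta>"
    by (auto simp: eps_lambda_nhd_def)
  have "nrm x \<in> carrier (L0 M)"
    using nrm_closed x by (auto simp: L0_plus_def)
  with f have [measurable]: "f \<in> borel_measurable M"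
    by (auto simp: L0_def L0_class_def)
  have "measure M {\<omega> \<in> space M. f \<omega> < \<epsilon>} \<le> measure M {\<omega> \<in> space M. f \<omega> < \<epsilon>'}"
    by (rule finite_measure_mono) (use assms in auto)
  with p assms have "measure M {\<omega> \<in> space M. f \<omega> < \<epsilon>'} > 1 - \<delta>'" by linarith
  with x f show "x \<in> eps_lambda_nhd M E nrm \<epsilon>' \<delta>'"
    by (auto simp: eps_lambda_nhd_def)
qed

lemma (in RN_module) istopology_eps_lambda: "istopology (eps_lambda_open M E nrm)"
  unfolding istopology_def
proof (intro conjI allI impI)
  fix S T assume S: "eps_lambda_open M E nrm S" and T: "eps_lambda_open M E nrm T"
  show "eps_lambda_open M E nrm (S \<inter> T)"
    unfolding eps_lambda_open_def
  proof (intro conjI ballI)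
    show "S \<inter> T \<subseteq> carrier E" using S by (auto simp: eps_lambda_open_def)
    fix x assume x: "x \<in> S \<inter> T"
    obtain e l where 1: "e > 0" "0 < l" "l < 1" "\<forall>v\<in>eps_lambda_nhd M E nrm e l. x \<oplus>\<^bsub>E\<^esub> v \<in> S"
      using S x by (auto simp: eps_lambda_open_def)
    obtain e' l' where 2: "e' > 0" "0 < l'" "l' < 1" "\<forall>v\<in>eps_lambda_nhd M E nrm e' l'. x \<oplus>\<^bsub>E\<^esub> v \<in> T"
      using T x by (auto simp: eps_lambda_open_def)
    have "eps_lambda_nhd M E nrm (min e e') (min l l') \<subseteq> eps_lambda_nhd M E nrm e l"
      "eps_lambda_nhd M E nrm (min e e') (min l l') \<subseteq> eps_lambda_nhd M E nrm e' l'"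
      by (intro eps_lambda_nhd_mono; simp)+
    with 1 2 show "\<exists>\<epsilon>>0. \<exists>\<delta>. 0 < \<delta> \<and> \<delta> < 1 \<and>
        (\<forall>v\<in>eps_lambda_nhd M E nrm \<epsilon> \<delta>. x \<oplus>\<^bsub>E\<^esub> v \<in> S \<inter> T)"
      by (intro exI[of _ "min e e'"] conjI exI[of _ "min l l'"]) auto
  qed
next
  fix \<K> assume K: "\<forall>K\<in>\<K>. eps_lambda_open M E nrm K"
  show "eps_lambda_open M E nrm (\<Union>\<K>)"
    unfolding eps_lambda_open_def
  proof (intro conjI ballI)
    show "\<Union>\<K> \<subseteq> carrier E" using K by (auto simp: eps_lambda_open_def)
    fix x assume "x \<in> \<Union>\<K>"
    then obtain U where "U \<in> \<K>" "x \<in> U" by blast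
    then show "\<exists>\<epsilon>>0. \<exists>\<delta>. 0 < \<delta> \<and> \<delta> < 1 \<and>
        (\<forall>v\<in>eps_lambda_nhd M E nrm \<epsilon> \<delta>. x \<oplus>\<^bsub>E\<^esub> v \<in> \<Union>\<K>)"
      using K unfolding eps_lambda_open_def by (meson UnionI)
  qed
qed

lemma (in RN_module) openin_eps_lambda:
  "openin (eps_lambda_topology M E nrm) U \<longleftrightarrow> eps_lambda_open M E nrm U"
  by (simp add: eps_lambda_topology_def istopology_eps_lambda topology_inverse')

definition L0_convex ::
    "'w measure \<Rightarrow> (('w \<Rightarrow> 'k::real_or_complex) set, 'e) module \<Rightarrow> 'e set \<Rightarrow> bool" where
  "L0_convex M E G \<longleftrightarrow> G \<noteq> {} \<and> G \<subseteq> carrier E \<and>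
     (\<forall>x\<in>G. \<forall>y\<in>G. \<forall>\<xi>\<in>L0_plus M. L0_le M \<xi> \<one>\<^bsub>L0 M\<^esub> \<longrightarrow>
        (L0_of_real M \<xi> \<odot>\<^bsub>E\<^esub> x) \<oplus>\<^bsub>E\<^esub> (L0_of_real M (\<one>\<^bsub>L0 M\<^esub> \<ominus>\<^bsub>L0 M\<^esub> \<xi>) \<odot>\<^bsub>E\<^esub> y) \<in> G)"

definition countable_partition :: "'w measure \<Rightarrow> (nat \<Rightarrow> 'w set) \<Rightarrow> bool" where
  "countable_partition M A \<longleftrightarrow>
     range A \<subseteq> sets M \<and> disjoint_family A \<and> (\<Union>n. A n) = space M"

definition is_concat ::
    "'w measure \<Rightarrow> (('w \<Rightarrow> 'k::real_or_complex) set, 'e) module \<Rightarrow>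
      (nat \<Rightarrow> 'w set) \<Rightarrow> (nat \<Rightarrow> 'e) \<Rightarrow> 'e \<Rightarrow> bool" where
  "is_concat M E A x z \<longleftrightarrow>
     z \<in> carrier E \<and> (\<forall>n. L0_ind M (A n) \<odot>\<^bsub>E\<^esub> z = L0_ind M (A n) \<odot>\<^bsub>E\<^esub> x n)"

text \<open>The countable concatenation \<open>\<Sum>\<^sub>n I\<^bsub>A n\<^esub> x\<^sub>n\<close>, unique in an RN module whenever it exists.\<close>

definition concatenation ::
    "'w measure \<Rightarrow> (('w \<Rightarrow> 'k::real_or_complex) set, 'e) module \<Rightarrow>
      (nat \<Rightarrow> 'w set) \<Rightarrow> (nat \<Rightarrow> 'e) \<Rightarrow> 'e" where
  "concatenation M E A x = (THE z. is_concat M E A x z)"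

definition sigma_stable ::
    "'w measure \<Rightarrow> (('w \<Rightarrow> 'k::real_or_complex) set, 'e) module \<Rightarrow> 'e set \<Rightarrow> bool" where
  "sigma_stable M E G \<longleftrightarrow> G \<noteq> {} \<and> G \<subseteq> carrier E \<and>
     (\<forall>x A. range x \<subseteq> G \<and> countable_partition M A \<longrightarrow> (\<exists>z\<in>G. is_concat M E A x z))"

text \<open>Sequences are indexed from 0, so the random indices \<open>n k\<close> range over all of \<^typ>\<open>nat\<close>
  instead of the positive integers.\<close>

definition random_indices :: "'w measure \<Rightarrow> (nat \<Rightarrow> 'w \<Rightarrow> nat) \<Rightarrow> bool" where
  "random_indices M n \<longleftrightarrow> (\<forall>k. n k \<in> measurable M (count_space UNIV)) \<and>
     (\<forall>k. \<forall>\<omega>\<in>space M. n k \<omega> < n (Suc k) \<omega>)"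

definition random_subsequence ::
    "'w measure \<Rightarrow> (('w \<Rightarrow> 'k::real_or_complex) set, 'e) module \<Rightarrow> 'e set \<Rightarrow>
      (nat \<Rightarrow> 'e) \<Rightarrow> (nat \<Rightarrow> 'e) \<Rightarrow> bool" where
  "random_subsequence M E H x y \<longleftrightarrow> range y \<subseteq> H \<and>
     (\<exists>n. random_indices M n \<and>
        (\<forall>k. y k = concatenation M E (\<lambda>l. {\<omega> \<in> space M. n k \<omega> = l}) x))"

text \<open>The set \<open>H\<close> is only an ambient \<open>\<sigma>\<close>-stable set in which the random subsequences of
  sequences in \<open>G\<close> are formed; by uniqueness of concatenations its choice is irrelevant.\<close>

definition random_seq_compact ::
    "'w measure \<Rightarrow> (('w \<Rightarrow> 'k::real_or_complex) set, 'e) module \<Rightarrow> ('e \<Rightarrow> ('w \<Rightarrow> real) set) \<Rightarrow>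
      'e set \<Rightarrow> bool" where
  "random_seq_compact M E nrm G \<longleftrightarrow> G \<noteq> {} \<and>
     (\<exists>H. sigma_stable M E H \<and> G \<subseteq> H \<and>
        (\<forall>x. range x \<subseteq> G \<longrightarrow>
           (\<exists>y. random_subsequence M E H x y \<and>
              (\<exists>z\<in>G. limitin (eps_lambda_topology M E nrm) y z sequentially))))"

definition sigma_stable_map ::
    "'w measure \<Rightarrow> (('w \<Rightarrow> 'k::real_or_complex) set, 'e) module \<Rightarrow> 'e set \<Rightarrow>
      (('w \<Rightarrow> 'k) set, 'f) module \<Rightarrow> 'f set \<Rightarrow> ('e \<Rightarrow> 'f) \<Rightarrow> bool" where
  "sigma_stable_map M E1 G1 E2 G2 T \<longleftrightarrow>
     sigma_stable M E1 G1 \<and> sigma_stable M E2 G2 \<and> T \<in> G1 \<rightarrow> G2 \<and>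
     (\<forall>A x. countable_partition M A \<and> range x \<subseteq> G1 \<longrightarrow>
        T (concatenation M E1 A x) = concatenation M E2 A (\<lambda>k. T (x k)))"

definition random_seq_continuous ::
    "'w measure \<Rightarrow>
      (('w \<Rightarrow> 'k::real_or_complex) set, 'e) module \<Rightarrow> ('e \<Rightarrow> ('w \<Rightarrow> real) set) \<Rightarrow> 'e set \<Rightarrow>
      (('w \<Rightarrow> 'k) set, 'f) module \<Rightarrow> ('f \<Rightarrow> ('w \<Rightarrow> real) set) \<Rightarrow> 'f set \<Rightarrow>
      ('e \<Rightarrow> 'f) \<Rightarrow> bool" where
  "random_seq_continuous M E1 nrm1 G1 E2 nrm2 G2 T \<longleftrightarrow>
     sigma_stable M E1 G1 \<and> G2 \<noteq> {} \<and> G2 \<subseteq> carrier E2 \<and> T \<in> G1 \<rightarrow> G2 \<and>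
     (\<forall>x0\<in>G1. \<forall>x. range x \<subseteq> G1 \<and> limitin (eps_lambda_topology M E1 nrm1) x x0 sequentially \<longrightarrow>
        (\<exists>y. random_subsequence M E1 G1 x y \<and>
           limitin (eps_lambda_topology M E2 nrm2) (\<lambda>k. T (y k)) (T x0) sequentially))"

end

theory Submission
  imports Defs
begin

text \<open>
  All classes are handled through representatives: \<open>rdist x y\<close> is a measurable version of
  \<open>\<parallel>x - y\<parallel>\<close>, and \<open>z\<close> is the concatenation of \<open>x\<close> along an \<open>\<nat>\<close>-valued random variable \<open>s\<close> iff
  \<open>rdist z (x (s \<omega>)) \<omega> = 0\<close> almost surely. Random sequential compactness yields a random total
  boundedness: for \<open>\<epsilon> > 0\<close> there is a sequence \<open>x\<close> in \<open>G\<close> such that \<open>\<Omega>\<close> is covered by countably many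
  events \<open>C n\<close> on which every element of \<open>G\<close> is within \<open>\<epsilon>\<close> of one of the first \<open>n\<close> points.

  Points of the standard simplex with deterministic coordinates \<open>v\<close> give convex combinations
  \<open>X v\<close> of these points. For a fine finite net of such \<open>v\<close>, label \<open>v\<close> by an index \<open>j v\<close> with
  \<open>x (j v)\<close> close to \<open>T (X v)\<close>. Brouwer's theorem for the map that interpolates the vertices
  \<open>e\<^bsub>j v\<^esub>\<close> gives \<open>c = \<Sum>\<^sub>v t v e\<^bsub>j v\<^esub>\<close> where \<open>t\<close> lives on the \<open>v\<close> near \<open>c\<close>. Then
  \<open>u = X c\<close> and the \<open>w = X v\<close>, \<open>t v > 0\<close>, that maximises \<open>\<parallel>T u - T w\<parallel>\<close> satisfy \<open>\<parallel>u - w\<parallel> \<le> \<epsilon>\<close> and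
  \<open>\<parallel>u - T u\<parallel> \<le> \<epsilon> + \<parallel>T u - T w\<parallel>\<close>. Only finitely many labellings occur for a given net, so no measurable
  selection is required and \<open>u\<close>, \<open>w\<close> are glued from countably many pieces. Along a random subsequence
  for \<open>\<epsilon> \<rightarrow> 0\<close>, both \<open>u\<close> and \<open>w\<close> converge to some \<open>z\<close> and both \<open>T u\<close> and \<open>T w\<close> to \<open>T z\<close>, so \<open>T z = z\<close>.
\<close>

subsection \<open>Brouwer's theorem in variable finite dimension\<close>

lemma tendsto_fun_iff:
  fixes x :: "nat \<Rightarrow> 'i \<Rightarrow> 'a::topological_space"
  shows "x \<longlonglongrightarrow> l \<longleftrightarrow> (\<forall>i. (\<lambda>k. x k i) \<longlonglongrightarrow> l i)"
  using limitin_componentwise[of "\<lambda>_. euclidean" UNIV x l sequentially]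
  by (simp add: euclidean_product_topology)

text \<open>Sequences vanishing from index \<open>n\<close> on encode the cube of dimension
  \<open>n\<close>, so that the dimension is an ordinary number that may vary within a
  proof.\<close>

definition fin_cube :: "nat \<Rightarrow> (nat \<Rightarrow> real) set" where
  "fin_cube n = {c. (\<forall>i. 0 \<le> c i \<and> c i \<le> 1) \<and> (\<forall>i\<ge>n. c i = 0)}"

definition std_simplex :: "nat \<Rightarrow> (nat \<Rightarrow> real) set" where
  "std_simplex n = {c. (\<forall>i. 0 \<le> c i) \<and> (\<forall>i\<ge>n. c i = 0) \<and> (\<Sum>i<n. c i) = 1}"

text \<open>Tychonoff: the cube is a product of unit intervals and, from index \<open>n\<close> on,
  of singletons.\<close>

lemma compact_fin_cube: "compact (fin_cube n)"
proof -
  have "fin_cube n = PiE UNIV (\<lambda>i. if i < n then {0..1} else {0})"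
    by (auto simp: fin_cube_def PiE_iff split: if_splits) (metis linorder_not_less order_refl zero_le_one)+
  moreover have "compactin (product_topology (\<lambda>_. euclidean) UNIV) 
      (PiE UNIV (\<lambda>i. if i < n then {0..1::real} else {0}))"
    by (auto simp: compactin_PiE)
  ultimately show ?thesis
    by (simp add: euclidean_product_topology)
qed

lemma fin_cube_tendsto_subseq:
  fixes x :: "nat \<Rightarrow> nat \<Rightarrow> real"
  assumes "\<And>k. x k \<in> fin_cube n"
  obtains l r where "l \<in> fin_cube n" "strict_mono r" "\<forall>i. (\<lambda>k. x (r k) i) \<longlonglongrightarrow> l i"
proof -
  have "seq_compact (fin_cube n)"
    using compact_fin_cube by (simp add: compact_eq_seq_compact_metric)
  then obtain l r where "l \<in> fin_cube n" "strict_mono r" "(x \<circ> r) \<longlonglongrightarrow> l"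
    unfolding seq_compact_def using assms by metis
  then show thesis
    using that by (auto simp: tendsto_fun_iff)
qed

text \<open>Kuhn's combinatorial lemma on the grid of mesh \<open>1 / p\<close> yields a cell on
  whose corners each of the \<open>n\<close> labels takes both values. Label \<open>i\<close>
  records whether \<open>f\<close> moves coordinate \<open>i\<close> up or down, so the two corners
  \<open>a\<close>, \<open>b\<close> depend on \<open>i\<close>.\<close>

lemma grid_almost_fixed:
  fixes f :: "(nat \<Rightarrow> real) \<Rightarrow> nat \<Rightarrow> real"
  assumes f: "f \<in> fin_cube n \<rightarrow> fin_cube n" and "0 < (p::nat)"
  shows "\<exists>z\<in>fin_cube n. \<forall>i<n. \<exists>a\<in>fin_cube n. \<exists>b\<in>fin_cube n.
    (\<forall>j. \<bar>a j - z j\<bar> \<le> 1 / p) \<and> (\<forall>j. \<bar>b j - z j\<bar> \<le> 1 / p) \<and> a i \<le> f a i \<and> f b i \<le> b i"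
proof -
  define pt :: "(nat \<Rightarrow> nat) \<Rightarrow> nat \<Rightarrow> real" where "pt q = (\<lambda>i. if i < n then q i / p else 0)" for q
  have pt: "pt q \<in> fin_cube n" if "\<forall>i<n. q i \<le> p" for q
    using that \<open>0 < p\<close> by (auto simp: fin_cube_def pt_def)
  have "\<forall>x. x \<in> fin_cube n \<longrightarrow> f x \<in> fin_cube n"
    "\<forall>x. x \<in> fin_cube n \<longrightarrow> (\<forall>i. i < n \<longrightarrow> 0 \<le> x i \<and> x i \<le> 1)"
    using f by (auto simp: fin_cube_def)
  \<comment> \<open>Label 0 means that \<open>f\<close> does not decrease the coordinate, label 1
    that it does not increase it; on the faces the label is prescribed, as the combinatorial lemma
    requires.\<close>
  from kuhn_labelling_lemma'[OF this] obtain l where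
    l1: "\<And>x i. l x i \<le> (1::nat)"
    and l2: "\<And>x i. \<lbrakk>x \<in> fin_cube n; i < n; x i = 0\<rbrakk> \<Longrightarrow> l x i = 0"
    and l3: "\<And>x i. \<lbrakk>x \<in> fin_cube n; i < n; x i = 1\<rbrakk> \<Longrightarrow> l x i = 1"
    and l4: "\<And>x i. \<lbrakk>x \<in> fin_cube n; i < n; l x i = 0\<rbrakk> \<Longrightarrow> x i \<le> f x i"
    and l5: "\<And>x i. \<lbrakk>x \<in> fin_cube n; i < n; l x i = 1\<rbrakk> \<Longrightarrow> f x i \<le> x i"
    by blast
  define lab where "lab q = l (pt q)" for q
  obtain q where q: "\<forall>i<n. q i < p"
    and qi: "\<forall>i<n. \<exists>r s. (\<forall>j<n. q j \<le> r j \<and> r j \<le> q j + 1) \<and> (\<forall>j<n. q j \<le> s j \<and> s j \<le> q j + 1)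
      \<and> lab r i \<noteq> lab s i"
  proof (rule kuhn_lemma[of p n lab])
    show "\<forall>x. (\<forall>i<n. x i \<le> p) \<longrightarrow> (\<forall>i<n. lab x i = 0 \<or> lab x i = 1)"
      using l1 by (metis lab_def le_neq_implies_less less_one)
    show "\<forall>x. (\<forall>i<n. x i \<le> p) \<longrightarrow> (\<forall>i<n. x i = 0 \<longrightarrow> lab x i = 0)"
      unfolding lab_def using pt by (intro allI impI l2) (auto simp: pt_def)
    show "\<forall>x. (\<forall>i<n. x i \<le> p) \<longrightarrow> (\<forall>i<n. x i = p \<longrightarrow> lab x i = 1)"
      unfolding lab_def using pt \<open>0 < p\<close> by (intro allI impI l3) (auto simp: pt_def)
  qed (use \<open>0 < p\<close> in auto)
  have close: "\<bar>pt r j - pt q j\<bar> \<le> 1 / p" if "\<forall>j<n. q j \<le> r j \<and> r j \<le> q j + 1" for r j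
  proof (cases "j < n")
    case True
    with that have "\<bar>real (r j) - real (q j)\<bar> \<le> 1" by (auto simp: abs_le_iff)
    moreover have "pt r j - pt q j = (real (r j) - real (q j)) / p"
      using True by (simp add: pt_def diff_divide_distrib)
    ultimately show ?thesis using \<open>0 < p\<close> by (simp add: divide_right_mono)
  qed (simp add: pt_def)
  have *: "\<exists>a\<in>fin_cube n. \<exists>b\<in>fin_cube n.
      (\<forall>j. \<bar>a j - pt q j\<bar> \<le> 1 / p) \<and> (\<forall>j. \<bar>b j - pt q j\<bar> \<le> 1 / p) \<and> a i \<le> f a i \<and> f b i \<le> b i"
    if i: "i < n" and r: "\<forall>j<n. q j \<le> r j \<and> r j \<le> q j + 1" and s: "\<forall>j<n. q j \<le> s j \<and> s j \<le> q j + 1"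
      and "lab r i = 0" "lab s i = 1" for r s i
  proof (rule bexI[of _ "pt r"], rule bexI[of _ "pt s"], intro conjI)
    have "\<forall>i<n. r i \<le> p" "\<forall>i<n. s i \<le> p"
      using q r s by (fastforce intro: order.trans)+
    then show "pt r \<in> fin_cube n" "pt s \<in> fin_cube n" by (auto intro: pt)
    then show "pt r i \<le> f (pt r) i" "f (pt s) i \<le> pt s i"
      using that by (auto simp: lab_def intro: l4 l5)
  qed (use close r s in auto)
  show ?thesis
  proof (rule bexI[of _ "pt q"], intro allI impI)
    show "pt q \<in> fin_cube n" using q by (auto intro: pt less_imp_le)
    fix i assume i: "i < n"
    obtain r s where rs: "\<forall>j<n. q j \<le> r j \<and> r j \<le> q j + 1" "\<forall>j<n. q j \<le> s j \<and> s j \<le> q j + 1"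
      "lab r i \<noteq> lab s i"
      using qi i by blast
    \<comment> \<open>It is not known which of the two corners carries which label, so
      \<open>*\<close> is applied in either order.\<close>
    have "lab r i = 0 \<and> lab s i = 1 \<or> lab s i = 0 \<and> lab r i = 1"
      using rs(3) l1[of "pt r" i] l1[of "pt s" i] unfolding lab_def by linarith
    with * i rs show "\<exists>a\<in>fin_cube n. \<exists>b\<in>fin_cube n.
      (\<forall>j. \<bar>a j - pt q j\<bar> \<le> 1 / p) \<and> (\<forall>j. \<bar>b j - pt q j\<bar> \<le> 1 / p) \<and> a i \<le> f a i \<and> f b i \<le> b i"
      by blast
  qed
qed

lemma continuous_on_tendsto_coordinate:
  fixes f :: "(nat \<Rightarrow> real) \<Rightarrow> nat \<Rightarrow> real"
  assumes f: "continuous_on S f" and "l \<in> S" "\<And>k. a k \<in> S" "\<And>j. (\<lambda>k. a k j) \<longlonglongrightarrow> l j"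
  shows "(\<lambda>k. f (a k) i) \<longlonglongrightarrow> f l i"
proof -
  have "a \<longlonglongrightarrow> l" using assms(4) by (simp add: tendsto_fun_iff)
  then have "(\<lambda>k. f (a k)) \<longlonglongrightarrow> f l"
    using f assms(2,3) by (intro continuous_on_tendsto_compose[OF f]) auto
  then show ?thesis by (simp add: tendsto_fun_iff)
qed

text \<open>The cells for mesh \<open>1 / Suc p\<close> shrink, along a subsequence, to one point
  \<open>x\<close>. By continuity the two opposite inequalities at the corners both pass to
  \<open>x\<close> and give equality in every coordinate.\<close>

theorem brouwer_fin_cube:
  fixes f :: "(nat \<Rightarrow> real) \<Rightarrow> nat \<Rightarrow> real"
  assumes cont: "continuous_on (fin_cube n) f" and f: "f \<in> fin_cube n \<rightarrow> fin_cube n"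
  shows "\<exists>x\<in>fin_cube n. f x = x"
proof -
  define R where "R p z i a b \<longleftrightarrow> a \<in> fin_cube n \<and> b \<in> fin_cube n \<and>
      (\<forall>j. \<bar>a j - z j\<bar> \<le> 1 / Suc p) \<and> (\<forall>j. \<bar>b j - z j\<bar> \<le> 1 / Suc p) \<and> a i \<le> f a i \<and> f b i \<le> b i"
    for p z i a b
  have "\<exists>z. z \<in> fin_cube n \<and> (\<forall>i<n. \<exists>a b. R p z i a b)" for p
  proof -
    obtain z where "z \<in> fin_cube n" and "\<forall>i<n. \<exists>a\<in>fin_cube n. \<exists>b\<in>fin_cube n.
        (\<forall>j. \<bar>a j - z j\<bar> \<le> 1 / Suc p) \<and> (\<forall>j. \<bar>b j - z j\<bar> \<le> 1 / Suc p) \<and> a i \<le> f a i \<and> f b i \<le> b i"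
      using grid_almost_fixed[OF f zero_less_Suc[of p]] by (elim bexE)
    then have "z \<in> fin_cube n \<and> (\<forall>i<n. \<exists>a b. R p z i a b)"
      unfolding R_def by (simp only: Bex_def simp_thms conj_assoc) (simp only: ex_simps simp_thms)
    then show ?thesis by (intro exI[of _ z])
  qed
  then obtain z where z: "\<And>p. z p \<in> fin_cube n" and R: "\<And>p. \<forall>i<n. \<exists>a b. R p (z p) i a b"
    by metis
  have "\<exists>a. \<forall>i<n. \<exists>b. R p (z p) i (a i) b" for p
    using R[of p] by metis
  then obtain a where "\<And>p. \<forall>i<n. \<exists>b. R p (z p) i (a p i) b" by metis
  then have "\<forall>p. \<exists>b. \<forall>i<n. R p (z p) i (a p i) (b i)" by metis
  then obtain b where R: "\<And>p i. i < n \<Longrightarrow> R p (z p) i (a p i) (b p i)" by metis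
  then have ab: "\<And>p i. i < n \<Longrightarrow> a p i \<in> fin_cube n" "\<And>p i. i < n \<Longrightarrow> b p i \<in> fin_cube n"
    and close: "\<And>p i j. i < n \<Longrightarrow> \<bar>a p i j - z p j\<bar> \<le> 1 / Suc p"
      "\<And>p i j. i < n \<Longrightarrow> \<bar>b p i j - z p j\<bar> \<le> 1 / Suc p"
    and le: "\<And>p i. i < n \<Longrightarrow> a p i i \<le> f (a p i) i" "\<And>p i. i < n \<Longrightarrow> f (b p i) i \<le> b p i i"
    unfolding R_def by blast+
  obtain x r where x: "x \<in> fin_cube n" and r: "strict_mono r"
    and lim: "\<forall>j. (\<lambda>k. z (r k) j) \<longlonglongrightarrow> x j"
    by (rule fin_cube_tendsto_subseq[where x = z, OF z])
  \<comment> \<open>One subsequence, chosen for \<open>z\<close>, serves all corners at once,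
    because they lie within the mesh of \<open>z\<close>.\<close>
  have lim': "(\<lambda>k. c (r k) j) \<longlonglongrightarrow> x j" if "\<And>p. \<bar>c p j - z p j\<bar> \<le> 1 / Suc p" for c :: "nat \<Rightarrow> nat \<Rightarrow> real" and j
  proof -
    have "(\<lambda>p. c p j - z p j) \<longlonglongrightarrow> 0"
      by (rule Lim_null_comparison[OF _ LIMSEQ_inverse_real_of_nat])
         (use that in \<open>auto simp: inverse_eq_divide\<close>)
    then have "(\<lambda>k. c (r k) j - z (r k) j) \<longlonglongrightarrow> 0"
      using LIMSEQ_subseq_LIMSEQ[OF _ r] by (fastforce simp: o_def)
    from tendsto_add[OF this spec[OF lim, of j]] show ?thesis by simp
  qed
  have "f x i = x i" for i
  proof (cases "i < n")
    case True
    have "x i \<le> f x i"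
    proof (rule LIMSEQ_le)
      show "(\<lambda>k. a (r k) i i) \<longlonglongrightarrow> x i"
        using True by (intro lim'[where c = "\<lambda>p. a p i"] close)
      show "(\<lambda>k. f (a (r k) i) i) \<longlonglongrightarrow> f x i"
        using True by (intro continuous_on_tendsto_coordinate[OF cont x] ab lim'[where c = "\<lambda>p. a p i"] close)
    qed (use le True in auto)
    moreover have "f x i \<le> x i"
    proof (rule LIMSEQ_le)
      show "(\<lambda>k. b (r k) i i) \<longlonglongrightarrow> x i"
        using True by (intro lim'[where c = "\<lambda>p. b p i"] close)
      show "(\<lambda>k. f (b (r k) i) i) \<longlonglongrightarrow> f x i"
        using True by (intro continuous_on_tendsto_coordinate[OF cont x] ab lim'[where c = "\<lambda>p. b p i"] close)
    qed (use le True in auto)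
    ultimately show ?thesis by simp
  next
    case False
    then show ?thesis using x f by (auto simp: fin_cube_def Pi_iff)
  qed
  with x show ?thesis by blast
qed

section \<open>Transfer of Brouwer's theorem to the standard simplex\<close>

lemma std_simplex_subset_fin_cube: "std_simplex n \<subseteq> fin_cube n"
proof
  fix c assume c: "c \<in> std_simplex n"
  have "c i \<le> 1" for i
  proof (cases "i < n")
    case True
    then have "c i \<le> (\<Sum>i<n. c i)"
      using c by (intro member_le_sum) (auto simp: std_simplex_def)
    then show ?thesis using c by (simp add: std_simplex_def)
  qed (use c in \<open>auto simp: std_simplex_def\<close>)
  then show "c \<in> fin_cube n" using c by (auto simp: fin_cube_def std_simplex_def)
qed

text \<open>The cube retracts onto the simplex by \<open>r\<close>. A fixed point of
  \<open>f \<circ> r\<close> in the cube is a value of \<open>f\<close>, hence lies in the simplex,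
  where \<open>r\<close> is the identity.\<close>

theorem brouwer_std_simplex:
  assumes cont: "continuous_on (std_simplex n) f" and f: "f \<in> std_simplex n \<rightarrow> std_simplex n"
    and n: "0 < n"
  shows "\<exists>x\<in>std_simplex n. f x = x"
proof -
  define s :: "(nat \<Rightarrow> real) \<Rightarrow> real" where "s c = (\<Sum>i<n. c i)" for c
  \<comment> \<open>The mass missing from 1, which \<open>r\<close> spreads evenly before
    normalising. The total \<open>s c + m c\<close> is the maximum of \<open>s c\<close> and 1, so
    the division is safe.\<close>
  define m :: "(nat \<Rightarrow> real) \<Rightarrow> real" where "m c = max 0 (1 - s c)" for c
  define r :: "(nat \<Rightarrow> real) \<Rightarrow> nat \<Rightarrow> real"
    where "r c = (\<lambda>i. if i < n then (c i + m c / n) / (s c + m c) else 0)" for c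
  have pos: "0 < s c + m c" for c by (simp add: m_def)
  have "continuous_on UNIV r"
    unfolding r_def
  proof (rule continuous_on_coordinatewise_then_product)
    fix i
    show "continuous_on UNIV (\<lambda>c. if i < n then (c i + m c / n) / (s c + m c) else 0)"
      using pos by (cases "i < n")
        (auto simp: m_def s_def less_imp_neq[symmetric] intro!: continuous_intros)
  qed
  have m0: "0 \<le> m c" for c by (simp add: m_def)
  have r: "r c \<in> std_simplex n" if "c \<in> fin_cube n" for c
  proof -
    have "0 \<le> r c i" for i
      using that m0[of c] pos[of c] by (auto simp: r_def fin_cube_def intro!: divide_nonneg_pos)
    moreover have "(\<Sum>i<n. r c i) = 1"
      using n pos[of c] by (simp add: r_def sum_divide_distrib[symmetric] sum.distrib s_def[symmetric])
    ultimately show ?thesis by (simp add: std_simplex_def r_def)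
  qed
  have r_id: "r c = c" if "c \<in> std_simplex n" for c
    using that by (auto simp: r_def s_def m_def std_simplex_def fun_eq_iff)
  have "\<exists>x\<in>fin_cube n. (f \<circ> r) x = x"
  proof (rule brouwer_fin_cube)
    show "continuous_on (fin_cube n) (f \<circ> r)"
      using r by (intro continuous_on_compose continuous_on_subset[OF \<open>continuous_on UNIV r\<close>]
        continuous_on_subset[OF cont]) auto
    show "f \<circ> r \<in> fin_cube n \<rightarrow> fin_cube n"
      using r f std_simplex_subset_fin_cube by fastforce
  qed
  then obtain x where x: "x \<in> fin_cube n" "f (r x) = x" by auto
  then have "x \<in> std_simplex n" using r f by (metis Pi_iff)
  then show ?thesis using x r_id by metis
qed

lemma compact_std_simplex: "compact (std_simplex n)"
proof -
  have "closed {c::nat \<Rightarrow> real. 0 \<le> c i}" "closed {c::nat \<Rightarrow> real. (\<Sum>i<n. c i) = 1}" for i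
    by (intro closed_Collect_le closed_Collect_eq continuous_intros continuous_on_product_coordinates)+
  then have "closed {c::nat \<Rightarrow> real. (\<Sum>i<n. c i) = 1}" by simp
  moreover have "std_simplex n = fin_cube n \<inter> {c. (\<Sum>i<n. c i) = 1}"
    using std_simplex_subset_fin_cube[of n] by (auto simp: std_simplex_def fin_cube_def)
  ultimately show ?thesis
    using compact_fin_cube by (simp add: compact_Int_closed)
qed

section \<open>Labelled nets in the standard simplex\<close>

lemma sum_over_fibres:
  fixes t :: "'v \<Rightarrow> real"
  assumes "finite V" "j ` V \<subseteq> {..<n::nat}"
  shows "(\<Sum>i<n. (\<Sum>v\<in>V. if j v = i then t v else 0) * g i) = (\<Sum>v\<in>V. t v * g (j v))"
proof -
  have "(\<Sum>i<n. (\<Sum>v\<in>V. if j v = i then t v else 0) * g i)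
      = (\<Sum>v\<in>V. \<Sum>i<n. (if j v = i then t v else 0) * g i)"
    by (subst sum.swap) (simp add: sum_distrib_right)
  also have "\<dots> = (\<Sum>v\<in>V. t v * g (j v))"
    by (rule sum.cong) (use assms(2) in \<open>auto simp: if_distrib[of "\<lambda>x. x * _"] cong: if_cong\<close>)
  finally show ?thesis .
qed

text \<open>A partition of unity \<open>w\<close> for the cover by \<delta>-balls around
  \<open>V\<close> makes \<open>c\<close> \<mapsto> \<Sum> \<open>w v c\<close> times the vertex
  number \<open>j v\<close> a continuous self-map of the simplex. At a Brouwer fixed point put
  \<open>t v = w v c\<close>. The net \<open>V\<close> is fixed before the labelling
  \<open>j\<close>, so only finitely many labellings of it will have to be considered.\<close>

theorem simplex_labelling:
  assumes n: "0 < n" and \<delta>: "0 < \<delta>"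
  shows "\<exists>V. finite V \<and> V \<subseteq> std_simplex n \<and> (\<forall>j. j ` V \<subseteq> {..<n} \<longrightarrow>
    (\<exists>c\<in>std_simplex n. \<exists>t. (\<forall>v\<in>V. 0 \<le> t v) \<and> sum t V = 1 \<and>
      (\<forall>i. c i = (\<Sum>v\<in>V. if j v = i then t v else 0)) \<and>
      (\<forall>v\<in>V. 0 < t v \<longrightarrow> (\<forall>i. \<bar>v i - c i\<bar> \<le> \<delta>))))"
proof -
  define dd :: "(nat \<Rightarrow> real) \<Rightarrow> (nat \<Rightarrow> real) \<Rightarrow> real" where "dd v c = (\<Sum>i<n. \<bar>c i - v i\<bar>)" for v c
  have cont_dd: "continuous_on A (dd v)" for A v
    unfolding dd_def by (intro continuous_intros continuous_on_subset[OF continuous_on_product_coordinates]) auto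
  have open_dd: "open {c. dd v c < \<delta>}" for v
    by (intro open_Collect_less cont_dd continuous_intros)
  have sub: "std_simplex n \<subseteq> (\<Union>v\<in>std_simplex n. {c. dd v c < \<delta>})"
    using \<delta> by (auto simp: dd_def)
  obtain V where V: "V \<subseteq> std_simplex n" "finite V"
    and UN: "std_simplex n \<subseteq> (\<Union>v\<in>V. {c. dd v c < \<delta>})"
    by (rule compactE_image[OF compact_std_simplex open_dd sub])
  have cover: "\<exists>v\<in>V. dd v c < \<delta>" if "c \<in> std_simplex n" for c
    using UN that by auto
  \<comment> \<open>A bump that is positive exactly on the ball around \<open>v\<close>; hence a
    positive weight forces closeness.\<close>
  define \<psi> where "\<psi> v c = max 0 (\<delta> - dd v c)" for v c
  define w where "w v c = \<psi> v c / (\<Sum>v\<in>V. \<psi> v c)" for v c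
  have pos: "0 < (\<Sum>v\<in>V. \<psi> v c)" if c: "c \<in> std_simplex n" for c
  proof -
    obtain v where "v \<in> V" "dd v c < \<delta>" using cover[OF c] by blast
    then show ?thesis using V(2) by (intro sum_pos2[of V v]) (auto simp: \<psi>_def)
  qed
  have w0: "0 \<le> w v c" if "c \<in> std_simplex n" for v c
    using pos[OF that] by (auto simp: w_def \<psi>_def)
  have w1: "(\<Sum>v\<in>V. w v c) = 1" if "c \<in> std_simplex n" for c
    using pos[OF that] by (simp add: w_def sum_divide_distrib[symmetric])
  have cont_w: "continuous_on (std_simplex n) (w v)" for v
    unfolding w_def \<psi>_def using pos[unfolded \<psi>_def]
    by (intro continuous_intros cont_dd) (metis less_irrefl)
  have "\<exists>c\<in>std_simplex n. \<exists>t. (\<forall>v\<in>V. 0 \<le> t v) \<and> sum t V = 1 \<and>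
      (\<forall>i. c i = (\<Sum>v\<in>V. if j v = i then t v else 0)) \<and>
      (\<forall>v\<in>V. 0 < t v \<longrightarrow> (\<forall>i. \<bar>v i - c i\<bar> \<le> \<delta>))" if j: "j ` V \<subseteq> {..<n}" for j
  proof -
    define f where "f c = (\<lambda>i. \<Sum>v\<in>V. if j v = i then w v c else 0)" for c
    have "\<exists>c\<in>std_simplex n. f c = c"
    proof (rule brouwer_std_simplex[OF _ _ n])
      show "continuous_on (std_simplex n) f"
        unfolding f_def
      proof (intro continuous_on_coordinatewise_then_product continuous_on_sum)
        fix i v show "continuous_on (std_simplex n) (\<lambda>c. if j v = i then w v c else 0)"
          using cont_w by (cases "j v = i") auto
      qed
      have "f c \<in> std_simplex n" if c: "c \<in> std_simplex n" for c
      proof -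
        have "f c i = 0" if "i \<ge> n" for i
          unfolding f_def using j that by (intro sum.neutral) auto
        then show ?thesis
          using w0[OF c] w1[OF c] sum_over_fibres[OF V(2) j, of "\<lambda>v. w v c" "\<lambda>_. 1"]
          by (auto simp: std_simplex_def f_def intro!: sum_nonneg)
      qed
      then show "f \<in> std_simplex n \<rightarrow> std_simplex n" by blast
    qed
    then obtain c where c: "c \<in> std_simplex n" "f c = c" by blast
    have "\<bar>v i - c i\<bar> \<le> \<delta>" if "v \<in> V" "0 < w v c" for v i
    proof (cases "i < n")
      case True
      have "dd v c < \<delta>"
        using that(2) pos[OF c(1)] by (auto simp: w_def \<psi>_def zero_less_divide_iff max_def split: if_splits)
      moreover have "\<bar>c i - v i\<bar> \<le> dd v c"
        unfolding dd_def using True by (intro member_le_sum) auto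
      ultimately show ?thesis by linarith
    next
      case False
      then show ?thesis using that V(1) c(1) \<delta> by (auto simp: std_simplex_def)
    qed
    with c w0 w1 show ?thesis
      by (intro bexI[of _ c] exI[of _ "\<lambda>v. w v c"]) (auto simp: f_def fun_eq_iff)
  qed
  with V show ?thesis by blast
qed

subsection \<open>The random norm through representatives\<close>

lemma L0_carrierE:
  assumes "X \<in> carrier (L0 M)"
  obtains f where "f \<in> borel_measurable M" "X = L0_class M f"
  using assms by (auto simp: L0_def)

lemma L0_class_carrier: "f \<in> borel_measurable M \<Longrightarrow> L0_class M f \<in> carrier (L0 M)"
  by (simp add: L0_def)

lemma
  fixes f g :: "'w \<Rightarrow> 'k::real_or_complex"
  assumes "f \<in> borel_measurable M" "g \<in> borel_measurable M"
  shows L0_class_mult: "L0_class M f \<otimes>\<^bsub>L0 M\<^esub> L0_class M g = L0_class M (\<lambda>\<omega>. f \<omega> * g \<omega>)"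
    and L0_class_add: "L0_class M f \<oplus>\<^bsub>L0 M\<^esub> L0_class M g = L0_class M (\<lambda>\<omega>. f \<omega> + g \<omega>)"
  using assms by (auto simp: L0_def L0_map2_class)

lemma L0_zero: "\<zero>\<^bsub>L0 M\<^esub> = L0_class M (\<lambda>_. 0)"
  and L0_one: "\<one>\<^bsub>L0 M\<^esub> = L0_class M (\<lambda>_. 1)"
  by (simp_all add: L0_def)

lemma L0_class_minus:
  fixes f g :: "'w \<Rightarrow> 'k::real_or_complex"
  assumes [measurable]: "f \<in> borel_measurable M" "g \<in> borel_measurable M"
  shows "L0_class M f \<ominus>\<^bsub>L0 M\<^esub> L0_class M g = L0_class M (\<lambda>\<omega>. f \<omega> - g \<omega>)"
proof -
  interpret cring "L0 M :: ('w \<Rightarrow> 'k) set ring" by (rule L0_cring)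
  have "\<ominus>\<^bsub>L0 M\<^esub> L0_class M g = L0_class M (\<lambda>\<omega>. - g \<omega>)"
    by (rule minus_equality) (simp_all add: L0_class_add L0_class_carrier L0_zero)
  then show ?thesis by (simp add: a_minus_def L0_class_add)
qed

lemma L0_le_class:
  assumes [measurable]: "f \<in> borel_measurable M" "g \<in> borel_measurable M"
  shows "L0_le M (L0_class M f) (L0_class M g) \<longleftrightarrow> (AE \<omega> in M. f \<omega> \<le> g \<omega>)"
proof
  assume "L0_le M (L0_class M f) (L0_class M g)"
  then obtain f' g' where "AE \<omega> in M. f' \<omega> = f \<omega>" "AE \<omega> in M. g' \<omega> = g \<omega>" "AE \<omega> in M. f' \<omega> \<le> g' \<omega>"
    by (auto simp: L0_le_def L0_class_def)
  then show "AE \<omega> in M. f \<omega> \<le> g \<omega>" by eventually_elim simp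
next
  assume "AE \<omega> in M. f \<omega> \<le> g \<omega>"
  then show "L0_le M (L0_class M f) (L0_class M g)"
    using L0_class_self[OF assms(1)] L0_class_self[OF assms(2)] by (auto simp: L0_le_def)
qed

context RN_module
begin

text \<open>A representative fixed once for each element makes pointwise evaluation possible; the
  laws of the norm hold for it almost surely.\<close>

definition rnorm :: "'e \<Rightarrow> 'w \<Rightarrow> real" where
  "rnorm x = (SOME f. f \<in> nrm x)"

lemma nrm_carrier: "x \<in> carrier E \<Longrightarrow> nrm x \<in> carrier (L0 M)"
  using nrm_closed by (auto simp: L0_plus_def)

lemma
  assumes "x \<in> carrier E"
  shows rnorm_measurable [measurable]: "rnorm x \<in> borel_measurable M"
    and nrm_eq: "nrm x = L0_class M (rnorm x)"
proof -
  obtain f where f: "f \<in> borel_measurable M" "nrm x = L0_class M f"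
    using nrm_carrier[OF assms] by (rule L0_carrierE)
  then have "rnorm x \<in> nrm x"
    unfolding rnorm_def using L0_class_self by (metis someI)
  with f show "rnorm x \<in> borel_measurable M" "nrm x = L0_class M (rnorm x)"
    by (auto simp: L0_class_eq_iff) (auto simp: L0_class_def)
qed

lemma rnorm_nonneg: "x \<in> carrier E \<Longrightarrow> AE \<omega> in M. 0 \<le> rnorm x \<omega>"
  using nrm_closed by (auto simp: L0_plus_def Pi_iff nrm_eq L0_zero L0_le_class)

lemma rnorm_smult:
  assumes [measurable]: "f \<in> borel_measurable M" and x: "x \<in> carrier E"
  shows "AE \<omega> in M. rnorm (L0_class M f \<odot>\<^bsub>E\<^esub> x) \<omega> = norm (f \<omega>) * rnorm x \<omega>"
proof -
  have "L0_class M (rnorm (L0_class M f \<odot>\<^bsub>E\<^esub> x)) = L0_class M (\<lambda>\<omega>. norm (f \<omega>) * rnorm x \<omega>)"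
    using nrm_smult[of "L0_class M f" x] x
    by (simp add: L0_class_carrier nrm_eq[symmetric] L0_abs_def L0_map_class)
       (simp add: nrm_eq L0_class_mult)
  then show ?thesis using x by (simp add: L0_class_eq_iff L0_class_carrier)
qed

lemma rnorm_add:
  assumes "x \<in> carrier E" "y \<in> carrier E"
  shows "AE \<omega> in M. rnorm (x \<oplus>\<^bsub>E\<^esub> y) \<omega> \<le> rnorm x \<omega> + rnorm y \<omega>"
  using nrm_triangle[OF assms] assms by (simp add: nrm_eq L0_class_add L0_le_class)

lemma smult_class_zero: "x \<in> carrier E \<Longrightarrow> L0_class M (\<lambda>_. 0) \<odot>\<^bsub>E\<^esub> x = \<zero>\<^bsub>E\<^esub>"
  by (simp add: L0_zero[symmetric])

lemma smult_class_one: "x \<in> carrier E \<Longrightarrow> L0_class M (\<lambda>_. 1) \<odot>\<^bsub>E\<^esub> x = x"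
  by (simp add: L0_one[symmetric])

lemma rnorm_zero: "AE \<omega> in M. rnorm \<zero>\<^bsub>E\<^esub> \<omega> = 0"
  using rnorm_smult[of "\<lambda>_. 0" "\<zero>\<^bsub>E\<^esub>"] by (simp add: smult_class_zero)

lemma rnorm_eq_zeroD:
  assumes "x \<in> carrier E" "AE \<omega> in M. rnorm x \<omega> = 0"
  shows "x = \<zero>\<^bsub>E\<^esub>"
  using assms by (intro nrm_eq_zero) (simp_all add: nrm_eq L0_zero L0_class_eq_iff)

lemma smult_class_minus_one: "x \<in> carrier E \<Longrightarrow> L0_class M (\<lambda>_. - 1) \<odot>\<^bsub>E\<^esub> x = \<ominus>\<^bsub>E\<^esub> x"
proof -
  assume x: "x \<in> carrier E"
  have "L0_class M (\<lambda>_. - 1) \<odot>\<^bsub>E\<^esub> x \<oplus>\<^bsub>E\<^esub> L0_class M (\<lambda>_. 1) \<odot>\<^bsub>E\<^esub> x = \<zero>\<^bsub>E\<^esub>"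
    using x by (subst E.smult_l_distr[symmetric]) (simp_all add: L0_class_carrier L0_class_add smult_class_zero)
  with x show ?thesis
    by (simp add: smult_class_one E.minus_equality L0_class_carrier)
qed

section \<open>The random distance and its almost sure metric laws\<close>

definition rdist :: "'e \<Rightarrow> 'e \<Rightarrow> 'w \<Rightarrow> real" where
  "rdist x y = rnorm (x \<ominus>\<^bsub>E\<^esub> y)"

lemma rdist_measurable [measurable]:
  "x \<in> carrier E \<Longrightarrow> y \<in> carrier E \<Longrightarrow> rdist x y \<in> borel_measurable M"
  by (simp add: rdist_def)

lemma rdist_nonneg: "x \<in> carrier E \<Longrightarrow> y \<in> carrier E \<Longrightarrow> AE \<omega> in M. 0 \<le> rdist x y \<omega>"
  by (simp add: rdist_def rnorm_nonneg)

lemma rdist_self: "x \<in> carrier E \<Longrightarrow> AE \<omega> in M. rdist x x \<omega> = 0"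
  using rnorm_zero by (simp add: rdist_def E.minus_eq E.r_neg)

lemma rdist_commute:
  assumes x: "x \<in> carrier E" and y: "y \<in> carrier E"
  shows "AE \<omega> in M. rdist x y \<omega> = rdist y x \<omega>"
proof -
  have "L0_class M (\<lambda>_. - 1) \<odot>\<^bsub>E\<^esub> (y \<ominus>\<^bsub>E\<^esub> x) = x \<ominus>\<^bsub>E\<^esub> y"
    using x y by (simp add: smult_class_minus_one E.minus_eq E.minus_add E.a_comm)
  then show ?thesis
    using rnorm_smult[of "\<lambda>_. - 1" "y \<ominus>\<^bsub>E\<^esub> x"] x y by (simp add: rdist_def)
qed

lemma rdist_triangle:
  assumes "x \<in> carrier E" "y \<in> carrier E" "z \<in> carrier E"
  shows "AE \<omega> in M. rdist x z \<omega> \<le> rdist x y \<omega> + rdist y z \<omega>"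
proof -
  have "(x \<ominus>\<^bsub>E\<^esub> y) \<oplus>\<^bsub>E\<^esub> (y \<ominus>\<^bsub>E\<^esub> z) = x \<ominus>\<^bsub>E\<^esub> z"
    using assms by (simp add: E.minus_eq E.a_assoc E.r_neg1)
  then show ?thesis
    using rnorm_add[of "x \<ominus>\<^bsub>E\<^esub> y" "y \<ominus>\<^bsub>E\<^esub> z"] assms by (simp add: rdist_def)
qed

lemma minus_eq_zero_iff: "x \<in> carrier E \<Longrightarrow> y \<in> carrier E \<Longrightarrow> x \<ominus>\<^bsub>E\<^esub> y = \<zero>\<^bsub>E\<^esub> \<longleftrightarrow> x = y"
  by (metis E.add.inv_closed E.add.m_comm E.add.inv_inv E.minus_equality E.minus_eq E.r_neg)

lemma rdist_eq_zeroD: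
  assumes "x \<in> carrier E" "y \<in> carrier E" "AE \<omega> in M. rdist x y \<omega> = 0"
  shows "x = y"
  using rnorm_eq_zeroD[of "x \<ominus>\<^bsub>E\<^esub> y"] assms by (simp add: rdist_def minus_eq_zero_iff)

text \<open>The norm of the indicator times \<open>x - y\<close> is the indicator times the
  distance, and an element is null iff its norm vanishes almost surely. This turns local equality on
  \<open>A\<close> into a pointwise statement.\<close>

lemma L0_ind_smult_eq_iff:
  assumes [measurable]: "A \<in> sets M" and x: "x \<in> carrier E" and y: "y \<in> carrier E"
  shows "L0_ind M A \<odot>\<^bsub>E\<^esub> x = L0_ind M A \<odot>\<^bsub>E\<^esub> y \<longleftrightarrow> (AE \<omega> in M. \<omega> \<in> A \<longrightarrow> rdist x y \<omega> = 0)"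
proof -
  let ?I = "L0_class M (indicator A :: 'w \<Rightarrow> 'k)"
  have I: "?I \<in> carrier (L0 M)" by (simp add: L0_class_carrier)
  have eq: "?I \<odot>\<^bsub>E\<^esub> x \<ominus>\<^bsub>E\<^esub> ?I \<odot>\<^bsub>E\<^esub> y = ?I \<odot>\<^bsub>E\<^esub> (x \<ominus>\<^bsub>E\<^esub> y)"
    using x y I by (simp add: E.minus_eq E.smult_r_distr E.smult_r_minus)
  have ae: "AE \<omega> in M. rnorm (?I \<odot>\<^bsub>E\<^esub> (x \<ominus>\<^bsub>E\<^esub> y)) \<omega> = norm (indicator A \<omega> :: 'k) * rnorm (x \<ominus>\<^bsub>E\<^esub> y) \<omega>"
    using x y by (intro rnorm_smult) auto
  have "?I \<odot>\<^bsub>E\<^esub> x = ?I \<odot>\<^bsub>E\<^esub> y \<longleftrightarrow> ?I \<odot>\<^bsub>E\<^esub> (x \<ominus>\<^bsub>E\<^esub> y) = \<zero>\<^bsub>E\<^esub>"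
    using x y I by (simp add: eq[symmetric] minus_eq_zero_iff)
  also have "\<dots> \<longleftrightarrow> (AE \<omega> in M. rnorm (?I \<odot>\<^bsub>E\<^esub> (x \<ominus>\<^bsub>E\<^esub> y)) \<omega> = 0)"
    using rnorm_zero rnorm_eq_zeroD[of "?I \<odot>\<^bsub>E\<^esub> (x \<ominus>\<^bsub>E\<^esub> y)"] x y I by auto
  also have "\<dots> \<longleftrightarrow> (AE \<omega> in M. \<omega> \<in> A \<longrightarrow> rdist x y \<omega> = 0)"
    by (rule eventually_cong[OF ae]) (auto simp: rdist_def indicator_def)
  finally show ?thesis by (simp add: L0_ind_def)
qed

lemma is_concat_iff:
  assumes "\<And>n. A n \<in> sets M" "\<And>n. x n \<in> carrier E"
  shows "is_concat M E A x z \<longleftrightarrow> z \<in> carrier E \<and> (\<forall>n. AE \<omega> in M. \<omega> \<in> A n \<longrightarrow> rdist z (x n) \<omega> = 0)"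
  using assms by (auto simp: is_concat_def L0_ind_smult_eq_iff)

section \<open>Concatenation along an integer-valued random variable\<close>

abbreviation level :: "('w \<Rightarrow> nat) \<Rightarrow> nat \<Rightarrow> 'w set" where
  "level s \<equiv> \<lambda>l. {\<omega> \<in> space M. s \<omega> = l}"

lemma level_sets: "s \<in> measurable M (count_space UNIV) \<Longrightarrow> level s l \<in> sets M"
  by simp

lemma countable_partition_level:
  "s \<in> measurable M (count_space UNIV) \<Longrightarrow> countable_partition M (level s)"
  by (auto simp: countable_partition_def disjoint_family_on_def)

text \<open>The exceptional null sets of the countably many levels unite to one null set, so the
  conditions merge into a single one at the random index \<open>s \<omega>\<close>.\<close>

lemma is_concat_level_iff:
  assumes [measurable]: "s \<in> measurable M (count_space UNIV)" and "\<And>n. x n \<in> carrier E"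
  shows "is_concat M E (level s) x z \<longleftrightarrow> z \<in> carrier E \<and> (AE \<omega> in M. rdist z (x (s \<omega>)) \<omega> = 0)"
proof -
  have "(AE \<omega> in M. rdist z (x (s \<omega>)) \<omega> = 0) \<longleftrightarrow>
      (AE \<omega> in M. \<forall>n. \<omega> \<in> level s n \<longrightarrow> rdist z (x n) \<omega> = 0)"
    by (intro AE_cong) auto
  also have "\<dots> \<longleftrightarrow> (\<forall>n. AE \<omega> in M. \<omega> \<in> level s n \<longrightarrow> rdist z (x n) \<omega> = 0)"
    by (rule AE_all_countable)
  finally show ?thesis
    using is_concat_iff[of "level s" x z] level_sets[OF assms(1)] assms(2) by simp
qed

text \<open>Two candidates both have distance 0 from \<open>x (s \<omega>)\<close>, hence from each
  other; this uniqueness resolves the definite description.\<close>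

lemma concatenation_level:
  assumes s: "s \<in> measurable M (count_space UNIV)" and x: "\<And>n. x n \<in> carrier E"
    and z: "z \<in> carrier E" "AE \<omega> in M. rdist z (x (s \<omega>)) \<omega> = 0"
  shows "concatenation M E (level s) x = z"
  unfolding concatenation_def
proof (rule the_equality)
  show "is_concat M E (level s) x z" using assms by (simp add: is_concat_level_iff)
  fix z' assume "is_concat M E (level s) x z'"
  then have z': "z' \<in> carrier E" "AE \<omega> in M. rdist z' (x (s \<omega>)) \<omega> = 0"
    using s x by (simp_all add: is_concat_level_iff)
  have "AE \<omega> in M. \<forall>n. rdist z' z \<omega> \<le> rdist z' (x n) \<omega> + rdist (x n) z \<omega>"
    "AE \<omega> in M. \<forall>n. rdist (x n) z \<omega> = rdist z (x n) \<omega>"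
    unfolding AE_all_countable by (intro allI rdist_triangle rdist_commute z' z x)+
  with rdist_nonneg[OF z'(1) z(1)] z(2) z'(2) have "AE \<omega> in M. rdist z' z \<omega> = 0"
    by eventually_elim (metis add.right_neutral order_antisym)
  with z' z show "z' = z" by (intro rdist_eq_zeroD)
qed

lemma sigma_stable_level:
  fixes s :: "'w \<Rightarrow> nat"
  assumes G: "sigma_stable M E G" and s: "s \<in> measurable M (count_space UNIV)" and x: "\<And>n. x n \<in> G"
  obtains z where "z \<in> G" "AE \<omega> in M. rdist z (x (s \<omega>)) \<omega> = 0"
proof -
  have sub: "G \<subseteq> carrier E" using G by (simp add: sigma_stable_def)
  obtain z where "z \<in> G" "is_concat M E (level s) x z"
    using G x countable_partition_level[OF s] unfolding sigma_stable_def image_subset_iff by blast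
  with that s x sub show thesis by (simp add: is_concat_level_iff subset_iff)
qed

end

subsection \<open>Convergence and convex combinations\<close>

context RN_module
begin

text \<open>The usual functional metrizing convergence in probability. The absolute value makes the
  integrand nonnegative everywhere, while \<open>rnorm\<close> is so only almost surely.\<close>

definition prob_norm :: "'e \<Rightarrow> real" where
  "prob_norm v = (\<integral>\<omega>. min 1 \<bar>rnorm v \<omega>\<bar> \<partial>M)"

lemma integrable_min_rnorm: "v \<in> carrier E \<Longrightarrow> integrable M (\<lambda>\<omega>. min 1 \<bar>rnorm v \<omega>\<bar>)"
  by (rule integrable_const_bound[where B = 1]) (auto intro!: AE_I2)

lemma prob_norm_add:
  assumes v: "v \<in> carrier E" and w: "w \<in> carrier E"
  shows "prob_norm (v \<oplus>\<^bsub>E\<^esub> w) \<le> prob_norm v + prob_norm w"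
proof -
  have "prob_norm (v \<oplus>\<^bsub>E\<^esub> w) \<le> (\<integral>\<omega>. min 1 \<bar>rnorm v \<omega>\<bar> + min 1 \<bar>rnorm w \<omega>\<bar> \<partial>M)"
    unfolding prob_norm_def
  proof (rule integral_mono_AE)
    show "AE \<omega> in M. min 1 \<bar>rnorm (v \<oplus>\<^bsub>E\<^esub> w) \<omega>\<bar> \<le> min 1 \<bar>rnorm v \<omega>\<bar> + min 1 \<bar>rnorm w \<omega>\<bar>"
      using rnorm_add[OF v w] rnorm_nonneg[OF v] rnorm_nonneg[OF w] rnorm_nonneg[OF E.a_closed[OF v w]]
      by eventually_elim (auto simp: min_def)
  qed (use v w in \<open>auto intro: integrable_min_rnorm Bochner_Integration.integrable_add\<close>)
  also have "\<dots> = prob_norm v + prob_norm w"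
    unfolding prob_norm_def using v w
    by (intro Bochner_Integration.integral_add integrable_min_rnorm)
  finally show ?thesis .
qed

text \<open>The integrand is at most \<epsilon> where the norm is below \<epsilon>, and at most 1 on
  the complement, whose probability is below \<delta>.\<close>

lemma prob_norm_less:
  assumes v: "v \<in> eps_lambda_nhd M E nrm \<epsilon> \<delta>" and "0 < \<epsilon>"
  shows "prob_norm v < \<epsilon> + \<delta>"
proof -
  obtain f where v: "v \<in> carrier E" and f: "f \<in> nrm v" and P: "measure M {\<omega> \<in> space M. f \<omega> < \<epsilon>} > 1 - \<delta>"
    using v by (auto simp: eps_lambda_nhd_def)
  have [measurable]: "f \<in> borel_measurable M" and f_eq: "AE \<omega> in M. f \<omega> = rnorm v \<omega>"
    using f v by (auto simp: nrm_eq L0_class_def)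
  let ?B = "{\<omega> \<in> space M. \<not> f \<omega> < \<epsilon>}"
  have iB: "integrable M (indicator ?B :: 'w \<Rightarrow> real)"
    by (simp add: integrable_indicator_iff emeasure_eq_measure)
  have "prob_norm v \<le> (\<integral>\<omega>. \<epsilon> + indicator ?B \<omega> \<partial>M)"
    unfolding prob_norm_def
  proof (rule integral_mono_AE)
    show "AE \<omega> in M. min 1 \<bar>rnorm v \<omega>\<bar> \<le> \<epsilon> + indicator ?B \<omega>"
      using f_eq rnorm_nonneg[OF v] AE_space
      by eventually_elim (use \<open>0 < \<epsilon>\<close> in \<open>auto simp: indicator_def\<close>)
  qed (use v iB in \<open>auto intro!: integrable_min_rnorm Bochner_Integration.integrable_add\<close>)
  also have "\<dots> = \<epsilon> + measure M ?B"
    using iB by (subst Bochner_Integration.integral_add) (auto simp: prob_space)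
  also have "measure M ?B = 1 - measure M {\<omega> \<in> space M. f \<omega> < \<epsilon>}"
    by (rule prob_neg) simp
  finally show ?thesis using P by simp
qed

lemma eps_lambda_open_prob_ball:
  assumes z: "z \<in> carrier E"
  shows "eps_lambda_open M E nrm {x \<in> carrier E. prob_norm (x \<ominus>\<^bsub>E\<^esub> z) < r}"
  unfolding eps_lambda_open_def
proof (intro conjI ballI)
  fix x assume "x \<in> {x \<in> carrier E. prob_norm (x \<ominus>\<^bsub>E\<^esub> z) < r}"
  then have x: "x \<in> carrier E" "prob_norm (x \<ominus>\<^bsub>E\<^esub> z) < r" by auto
  \<comment> \<open>A perturbation with both parameters equal to \<epsilon> costs less than twice
    \<epsilon>, hence half of the remaining gap; the cap \<open>1 / 2\<close> keeps the second
    parameter below 1.\<close>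
  define \<epsilon> where "\<epsilon> = min ((r - prob_norm (x \<ominus>\<^bsub>E\<^esub> z)) / 2) (1 / 2)"
  have "0 < \<epsilon>" "\<epsilon> < 1" using x by (auto simp: \<epsilon>_def)
  moreover have "\<forall>v\<in>eps_lambda_nhd M E nrm \<epsilon> \<epsilon>. x \<oplus>\<^bsub>E\<^esub> v \<in> {x \<in> carrier E. prob_norm (x \<ominus>\<^bsub>E\<^esub> z) < r}"
  proof
    fix v assume v: "v \<in> eps_lambda_nhd M E nrm \<epsilon> \<epsilon>"
    then have vE: "v \<in> carrier E" by (simp add: eps_lambda_nhd_def)
    have "(x \<oplus>\<^bsub>E\<^esub> v) \<ominus>\<^bsub>E\<^esub> z = (x \<ominus>\<^bsub>E\<^esub> z) \<oplus>\<^bsub>E\<^esub> v"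
      using x vE z by (simp add: E.minus_eq E.a_ac)
    then have "prob_norm ((x \<oplus>\<^bsub>E\<^esub> v) \<ominus>\<^bsub>E\<^esub> z) \<le> prob_norm (x \<ominus>\<^bsub>E\<^esub> z) + prob_norm v"
      using prob_norm_add[of "x \<ominus>\<^bsub>E\<^esub> z" v] x vE z by simp
    also have "\<dots> < prob_norm (x \<ominus>\<^bsub>E\<^esub> z) + (\<epsilon> + \<epsilon>)"
      using prob_norm_less[OF v \<open>0 < \<epsilon>\<close>] by simp
    also have "\<dots> \<le> r"
      unfolding \<epsilon>_def min_def by (simp add: field_simps)
    finally show "x \<oplus>\<^bsub>E\<^esub> v \<in> {x \<in> carrier E. prob_norm (x \<ominus>\<^bsub>E\<^esub> z) < r}"
      using x vE by simp
  qed
  ultimately show "\<exists>\<epsilon>>0. \<exists>\<delta>. 0 < \<delta> \<and> \<delta> < 1 \<and>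
      (\<forall>v\<in>eps_lambda_nhd M E nrm \<epsilon> \<delta>. x \<oplus>\<^bsub>E\<^esub> v \<in> {x \<in> carrier E. prob_norm (x \<ominus>\<^bsub>E\<^esub> z) < r})"
    by blast
qed auto

lemma topspace_eps_lambda: "topspace (eps_lambda_topology M E nrm) = carrier E"
proof -
  have "openin (eps_lambda_topology M E nrm) (carrier E)"
    unfolding openin_eps_lambda eps_lambda_open_def
    by (auto simp: eps_lambda_nhd_def intro!: exI[of _ "1/2 :: real"])
  moreover have "topspace (eps_lambda_topology M E nrm) \<subseteq> carrier E"
    using openin_topspace[of "eps_lambda_topology M E nrm"]
    unfolding openin_eps_lambda by (simp add: eps_lambda_open_def)
  ultimately show ?thesis by (intro subset_antisym openin_subset)
qed

text \<open>The balls of \<open>prob_norm\<close> are open, so topological convergence makes the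
  truncated distances tend to 0 in mean; a subsequence then tends to 0 almost surely.\<close>

lemma limitin_AE_subseq:
  assumes lim: "limitin (eps_lambda_topology M E nrm) y z sequentially"
    and y: "\<And>k. y k \<in> carrier E"
  obtains r where "strict_mono r" "AE \<omega> in M. (\<lambda>k. rdist (y (r k)) z \<omega>) \<longlonglongrightarrow> 0"
proof -
  have z: "z \<in> carrier E" using lim by (simp add: limitin_def topspace_eps_lambda)
  let ?f = "\<lambda>k \<omega>. min 1 \<bar>rdist (y k) z \<omega>\<bar>"
  have "\<forall>\<^sub>F k in sequentially. prob_norm (y k \<ominus>\<^bsub>E\<^esub> z) < r" if "0 < r" for r
  proof -
    have "prob_norm (z \<ominus>\<^bsub>E\<^esub> z) = 0"
    proof -
      have "prob_norm (z \<ominus>\<^bsub>E\<^esub> z) = (\<integral>\<omega>. 0 \<partial>M)"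
        unfolding prob_norm_def using rdist_self[OF z] z
        by (intro integral_cong_AE) (auto simp: rdist_def)
      then show ?thesis by simp
    qed
    with eps_lambda_open_prob_ball[OF z, of r] lim z that show ?thesis
      by (auto simp: limitin_def openin_eps_lambda elim!: allE[of _ "{x \<in> carrier E. prob_norm (x \<ominus>\<^bsub>E\<^esub> z) < r}"]
          elim: eventually_mono)
  qed
  moreover have "0 \<le> prob_norm v" for v by (simp add: prob_norm_def)
  ultimately have "(\<lambda>k. \<integral>\<omega>. norm (?f k \<omega>) \<partial>M) \<longlonglongrightarrow> 0"
    unfolding tendsto_iff by (simp add: prob_norm_def rdist_def)
  moreover have "integrable M (?f k)" for k
    using integrable_min_rnorm[of "y k \<ominus>\<^bsub>E\<^esub> z"] y z by (simp add: rdist_def)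
  ultimately obtain r :: "nat \<Rightarrow> nat" where r: "strict_mono r" and "AE \<omega> in M. (\<lambda>k. ?f (r k) \<omega>) \<longlonglongrightarrow> 0"
    using tendsto_L1_AE_subseq[of M ?f] by blast
  \<comment> \<open>The truncation at 1 is eventually inactive along a null sequence.\<close>
  moreover have "(\<lambda>k. a k) \<longlonglongrightarrow> 0" if a: "(\<lambda>k. min 1 \<bar>a k\<bar>) \<longlonglongrightarrow> 0" for a :: "nat \<Rightarrow> real"
  proof -
    have "\<forall>\<^sub>F k in sequentially. min 1 \<bar>a k\<bar> < 1" using order_tendstoD(2)[OF a] by simp
    then have "\<forall>\<^sub>F k in sequentially. min 1 \<bar>a k\<bar> = \<bar>a k\<bar>" by eventually_elim auto
    from tendsto_cong[OF this] a show ?thesis by (simp add: tendsto_rabs_zero_iff)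
  qed
  ultimately show thesis by (intro that[of r]) (auto elim: eventually_mono)
qed

text \<open>Dominated convergence for the indicators of the events that the distance is at least
  \<epsilon> shows that their probabilities vanish in the limit.\<close>

lemma AE_limitin:
  assumes y: "\<And>k. y k \<in> carrier E" and z: "z \<in> carrier E"
    and lim: "AE \<omega> in M. (\<lambda>k. rdist (y k) z \<omega>) \<longlonglongrightarrow> 0"
  shows "limitin (eps_lambda_topology M E nrm) y z sequentially"
  unfolding limitin_def topspace_eps_lambda openin_eps_lambda
proof (intro conjI allI impI z)
  fix U assume "eps_lambda_open M E nrm U \<and> z \<in> U"
  then obtain \<epsilon> \<delta> where pos: "0 < \<epsilon>" "0 < \<delta>" and U: "\<And>v. v \<in> eps_lambda_nhd M E nrm \<epsilon> \<delta> \<Longrightarrow> z \<oplus>\<^bsub>E\<^esub> v \<in> U"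
    unfolding eps_lambda_open_def by metis
  let ?B = "\<lambda>k. {\<omega> \<in> space M. \<not> rdist (y k) z \<omega> < \<epsilon>}"
  have [measurable]: "rdist (y k) z \<in> borel_measurable M" for k using y z by simp
  have "(\<lambda>k. \<integral>\<omega>. indicator (?B k) \<omega> \<partial>M) \<longlonglongrightarrow> (\<integral>\<omega>. (0::real) \<partial>M)"
  proof (rule integral_dominated_convergence[where w = "\<lambda>_. 1"])
    show "AE \<omega> in M. (\<lambda>k. indicator (?B k) \<omega> :: real) \<longlonglongrightarrow> 0"
      using lim
    proof eventually_elim
      fix \<omega> assume "(\<lambda>k. rdist (y k) z \<omega>) \<longlonglongrightarrow> 0"
      then have "\<forall>\<^sub>F k in sequentially. rdist (y k) z \<omega> < \<epsilon>" using pos(1) by (rule order_tendstoD)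
      then have "\<forall>\<^sub>F k in sequentially. indicator (?B k) \<omega> = (0::real)"
        by eventually_elim simp
      then show "(\<lambda>k. indicator (?B k) \<omega> :: real) \<longlonglongrightarrow> 0" by (rule tendsto_eventually)
    qed
  qed (auto simp: indicator_def)
  then have "(\<lambda>k. measure M (?B k)) \<longlonglongrightarrow> 0" by simp
  then have "\<forall>\<^sub>F k in sequentially. measure M (?B k) < \<delta>"
    using pos by (intro order_tendstoD)
  then show "\<forall>\<^sub>F k in sequentially. y k \<in> U"
  proof eventually_elim
    fix k assume "measure M (?B k) < \<delta>"
    moreover have "measure M (?B k) = 1 - measure M {\<omega> \<in> space M. rdist (y k) z \<omega> < \<epsilon>}"
      by (rule prob_neg) simp
    moreover have "rnorm (y k \<ominus>\<^bsub>E\<^esub> z) \<in> nrm (y k \<ominus>\<^bsub>E\<^esub> z)"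
      using y z by (simp add: nrm_eq L0_class_self)
    ultimately have "y k \<ominus>\<^bsub>E\<^esub> z \<in> eps_lambda_nhd M E nrm \<epsilon> \<delta>"
      using y z unfolding eps_lambda_nhd_def rdist_def
      by (intro CollectI conjI bexI[of _ "rnorm (y k \<ominus>\<^bsub>E\<^esub> z)"]) auto
    moreover have "z \<oplus>\<^bsub>E\<^esub> (y k \<ominus>\<^bsub>E\<^esub> z) = y k"
      using y[of k] z by (simp add: E.minus_eq E.a_lcomm[of z] E.r_neg)
    ultimately show "y k \<in> U" using U by metis
  qed
qed

section \<open>Convex combinations with deterministic coefficients\<close>

definition real_smult :: "real \<Rightarrow> 'e \<Rightarrow> 'e" where
  "real_smult r x = L0_class M (\<lambda>_. of_real r) \<odot>\<^bsub>E\<^esub> x"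

lemma real_smult_closed [simp]: "x \<in> carrier E \<Longrightarrow> real_smult r x \<in> carrier E"
  by (simp add: real_smult_def L0_class_carrier)

lemma real_smult_0: "x \<in> carrier E \<Longrightarrow> real_smult 0 x = \<zero>\<^bsub>E\<^esub>"
  and real_smult_1: "x \<in> carrier E \<Longrightarrow> real_smult 1 x = x"
  by (simp_all add: real_smult_def smult_class_zero smult_class_one)

lemma real_smult_add_left:
  "x \<in> carrier E \<Longrightarrow> real_smult (r + s) x = real_smult r x \<oplus>\<^bsub>E\<^esub> real_smult s x"
  by (simp add: real_smult_def E.smult_l_distr[symmetric] L0_class_carrier L0_class_add)

lemma real_smult_minus_left:
  "x \<in> carrier E \<Longrightarrow> real_smult (r - s) x = real_smult r x \<ominus>\<^bsub>E\<^esub> real_smult s x"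
  using real_smult_add_left[of x "r - s" s]
  by (simp add: E.minus_eq E.a_assoc E.r_neg)

lemma real_smult_real_smult: "x \<in> carrier E \<Longrightarrow> real_smult r (real_smult s x) = real_smult (r * s) x"
  by (simp add: real_smult_def E.smult_assoc1[symmetric] L0_class_carrier L0_class_mult)

lemma real_smult_add_right:
  "x \<in> carrier E \<Longrightarrow> y \<in> carrier E \<Longrightarrow> real_smult r (x \<oplus>\<^bsub>E\<^esub> y) = real_smult r x \<oplus>\<^bsub>E\<^esub> real_smult r y"
  by (simp add: real_smult_def E.smult_r_distr L0_class_carrier)

lemma real_smult_minus_right:
  "x \<in> carrier E \<Longrightarrow> y \<in> carrier E \<Longrightarrow> real_smult r (x \<ominus>\<^bsub>E\<^esub> y) = real_smult r x \<ominus>\<^bsub>E\<^esub> real_smult r y"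
  by (simp add: real_smult_def E.smult_r_distr E.smult_r_minus E.minus_eq L0_class_carrier)

lemma rnorm_real_smult: "x \<in> carrier E \<Longrightarrow> AE \<omega> in M. rnorm (real_smult r x) \<omega> = \<bar>r\<bar> * rnorm x \<omega>"
  using rnorm_smult[of "\<lambda>_. of_real r" x] by (simp add: real_smult_def)

primrec comb :: "nat \<Rightarrow> (nat \<Rightarrow> real) \<Rightarrow> (nat \<Rightarrow> 'e) \<Rightarrow> 'e" where
  "comb 0 c x = \<zero>\<^bsub>E\<^esub>"
| "comb (Suc n) c x = comb n c x \<oplus>\<^bsub>E\<^esub> real_smult (c n) (x n)"

lemma comb_closed [simp]: "(\<And>i. x i \<in> carrier E) \<Longrightarrow> comb n c x \<in> carrier E"
  by (induction n) auto

lemma rnorm_comb: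
  assumes x: "\<And>i. x i \<in> carrier E"
  shows "AE \<omega> in M. rnorm (comb n c x) \<omega> \<le> (\<Sum>i<n. \<bar>c i\<bar> * rnorm (x i) \<omega>)"
proof (induction n)
  case 0
  then show ?case using rnorm_zero by (auto elim: eventually_mono)
next
  case (Suc n)
  have "AE \<omega> in M. rnorm (comb (Suc n) c x) \<omega> \<le> rnorm (comb n c x) \<omega> + rnorm (real_smult (c n) (x n)) \<omega>"
    using rnorm_add[of "comb n c x" "real_smult (c n) (x n)"] x by simp
  with Suc rnorm_real_smult[OF x, of "c n" n] show ?case
    by eventually_elim simp
qed

lemma add_minus_add:
  assumes "a \<in> carrier E" "b \<in> carrier E" "c \<in> carrier E" "d \<in> carrier E"
  shows "(a \<oplus>\<^bsub>E\<^esub> b) \<ominus>\<^bsub>E\<^esub> (c \<oplus>\<^bsub>E\<^esub> d) = (a \<ominus>\<^bsub>E\<^esub> c) \<oplus>\<^bsub>E\<^esub> (b \<ominus>\<^bsub>E\<^esub> d)"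
  using assms by (simp add: E.minus_eq E.minus_add E.a_ac)

lemma comb_diff:
  assumes x: "\<And>i. x i \<in> carrier E"
  shows "comb n c x \<ominus>\<^bsub>E\<^esub> comb n d x = comb n (\<lambda>i. c i - d i) x"
proof (induction n)
  case (Suc n)
  then show ?case using x by (simp add: add_minus_add real_smult_minus_left)
qed (simp add: minus_eq_zero_iff)

lemma comb_shift:
  assumes x: "\<And>i. x i \<in> carrier E" and y: "y \<in> carrier E"
  shows "comb n c x \<ominus>\<^bsub>E\<^esub> real_smult (\<Sum>i<n. c i) y = comb n c (\<lambda>i. x i \<ominus>\<^bsub>E\<^esub> y)"
proof (induction n)
  case (Suc n)
  then show ?case using x y by (simp add: add_minus_add real_smult_add_left real_smult_minus_right)
qed (use y in \<open>simp add: real_smult_0 minus_eq_zero_iff\<close>)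

lemma real_smult_comb:
  assumes x: "\<And>i. x i \<in> carrier E"
  shows "real_smult r (comb n c x) = comb n (\<lambda>i. r * c i) x"
proof (induction n)
  case (Suc n)
  then show ?case using x by (simp add: real_smult_add_right real_smult_real_smult)
qed (simp add: real_smult_def L0_class_carrier)

text \<open>As the coefficients sum to 1, \<open>y\<close> is the combination of \<open>n\<close>
  copies of itself, and the difference is the combination of the \<open>x i - y\<close>.\<close>

lemma rdist_comb:
  assumes x: "\<And>i. x i \<in> carrier E" and y: "y \<in> carrier E" and c: "(\<Sum>i<n. c i) = 1"
  shows "AE \<omega> in M. rdist (comb n c x) y \<omega> \<le> (\<Sum>i<n. \<bar>c i\<bar> * rdist (x i) y \<omega>)"
  using rnorm_comb[of "\<lambda>i. x i \<ominus>\<^bsub>E\<^esub> y" n c] comb_shift[OF x y, of n c] x y c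
  by (simp add: rdist_def real_smult_1)

lemma rdist_comb_comb:
  assumes x: "\<And>i. x i \<in> carrier E"
  shows "AE \<omega> in M. rdist (comb n c x) (comb n d x) \<omega> \<le> (\<Sum>i<n. \<bar>c i - d i\<bar> * rnorm (x i) \<omega>)"
  using rnorm_comb[OF x, of n "\<lambda>i. c i - d i"] by (simp add: rdist_def comb_diff[OF x])

lemma L0_convex_real:
  assumes G: "L0_convex M E G" and "x \<in> G" "y \<in> G" and r: "0 \<le> r" "r \<le> 1"
  shows "real_smult r x \<oplus>\<^bsub>E\<^esub> real_smult (1 - r) y \<in> G"
proof -
  let ?\<xi> = "L0_class M (\<lambda>_. r)"
  have "?\<xi> \<in> L0_plus M" "L0_le M ?\<xi> \<one>\<^bsub>L0 M\<^esub>"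
    using r by (auto simp: L0_plus_def L0_class_carrier L0_zero L0_one L0_le_class)
  with assms have "(L0_of_real M ?\<xi> \<odot>\<^bsub>E\<^esub> x) \<oplus>\<^bsub>E\<^esub> (L0_of_real M (\<one>\<^bsub>L0 M\<^esub> \<ominus>\<^bsub>L0 M\<^esub> ?\<xi>) \<odot>\<^bsub>E\<^esub> y) \<in> G"
    by (auto simp: L0_convex_def)
  then show ?thesis
    by (simp add: real_smult_def L0_of_real_def L0_one L0_class_minus L0_map_class)
qed

text \<open>Induction on \<open>n\<close>: the last point is split off and the other weights are
  renormalised by their sum \<open>s\<close>, leaving a convex combination of two points of
  \<open>G\<close>.\<close>

lemma comb_in_convex:
  assumes G: "L0_convex M E G" and x: "\<And>i. x i \<in> G"
    and c: "\<And>i. 0 \<le> c i" "(\<Sum>i<n. c i) = 1"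
  shows "comb n c x \<in> G"
  using c
proof (induction n arbitrary: c)
  case (Suc n)
  have xE: "x i \<in> carrier E" for i using G x by (auto simp: L0_convex_def)
  define s where "s = (\<Sum>i<n. c i)"
  have s: "0 \<le> s" "c n = 1 - s" "s \<le> 1"
    using Suc.prems(1)[of n] Suc.prems(2) sum_nonneg[of "{..<n}" c] Suc.prems(1)
    unfolding s_def by (simp_all, linarith+)
  show ?case
  \<comment> \<open>For \<open>s = 0\<close> one cannot renormalise, but then all weights before the
    last vanish and the combination is \<open>x n\<close>.\<close>
  proof (cases "s = 0")
    case True
    then have "\<forall>i<n. c i = 0"
      using Suc.prems(1) by (auto simp: s_def sum_nonneg_eq_0_iff)
    then have "comb n c x = \<zero>\<^bsub>E\<^esub>"
    proof (induction n)
      case (Suc n)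
      then show ?case using xE by (simp add: real_smult_0)
    qed simp
    then show ?thesis using True s xE x by (simp add: real_smult_1)
  next
    case False
    have "comb n (\<lambda>i. c i / s) x \<in> G"
      using Suc.prems False s by (intro Suc.IH) (auto simp: sum_divide_distrib[symmetric] s_def)
    from L0_convex_real[OF G this x s(1,3), of n]
    show ?thesis using False s xE by (simp add: real_smult_comb)
  qed
qed simp

text \<open>Each law fails on a null set depending on the points; countability of \<open>S\<close>
  gives one common null set. Outside it, ordinary metric estimates are valid at a fixed \<omega>,
  even when the points are selected by indices depending on \<omega>.\<close>

lemma AE_rdist_metric:
  assumes S: "countable S" "S \<subseteq> carrier E"
  shows "AE \<omega> in M. \<forall>p\<in>S. \<forall>q\<in>S. \<forall>r\<in>S. 0 \<le> rdist p q \<omega> \<and> rdist p p \<omega> = 0 \<and>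
    rdist p q \<omega> = rdist q p \<omega> \<and> rdist p r \<omega> \<le> rdist p q \<omega> + rdist q r \<omega>"
proof -
  have "AE \<omega> in M. 0 \<le> rdist p q \<omega> \<and> rdist p p \<omega> = 0 \<and>
    rdist p q \<omega> = rdist q p \<omega> \<and> rdist p r \<omega> \<le> rdist p q \<omega> + rdist q r \<omega>"
    if "p \<in> S" "q \<in> S" "r \<in> S" for p q r
    using that S(2) by (intro AE_conjI rdist_nonneg rdist_self rdist_commute rdist_triangle) auto
  then show ?thesis by (simp only: AE_ball_countable[OF S(1)]) blast
qed

text \<open>Replacing a point by one at distance 0 leaves distances unchanged. This is how a glued
  element is exchanged for its piece at the random index.\<close>

lemma rdist_random_cong:
  fixes x y :: "nat \<Rightarrow> 'e"
  assumes x: "\<And>n. x n \<in> carrier E" and y: "\<And>n. y n \<in> carrier E"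
    and a: "a \<in> carrier E" "AE \<omega> in M. rdist a (x (s \<omega>)) \<omega> = 0"
    and b: "b \<in> carrier E" "AE \<omega> in M. rdist b (y (t \<omega>)) \<omega> = 0"
  shows "AE \<omega> in M. rdist a b \<omega> = rdist (x (s \<omega>)) (y (t \<omega>)) \<omega>"
proof -
  define S where "S = insert a (insert b (range x \<union> range y))"
  have S: "a \<in> S" "b \<in> S" "x n \<in> S" "y n \<in> S" for n by (auto simp: S_def)
  have "countable S" "S \<subseteq> carrier E" using x y a b by (auto simp: S_def)
  from AE_rdist_metric[OF this] a(2) b(2) show ?thesis
  proof eventually_elim
    case (elim \<omega>)
    have tri: "rdist p r \<omega> \<le> rdist p q \<omega> + rdist q r \<omega>" and sym: "rdist p q \<omega> = rdist q p \<omega>"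
      if "p \<in> S" "q \<in> S" "r \<in> S" for p q r
      using elim(1) that by auto
    note X = S(3)[of "s \<omega>"] and Y = S(4)[of "t \<omega>"]
    show ?case
      using tri[OF S(1) X S(2)] tri[OF X Y S(2)] tri[OF X S(1) Y] tri[OF S(1,2) Y]
        sym[OF S(1) X X] sym[OF S(2) Y Y] elim(2,3)
      by linarith
  qed
qed

lemma rdist_random_cong1:
  fixes x :: "nat \<Rightarrow> 'e"
  assumes x: "\<And>n. x n \<in> carrier E" and a: "a \<in> carrier E" and b: "b \<in> carrier E"
    and eq: "AE \<omega> in M. rdist a (x (s \<omega>)) \<omega> = 0"
  shows "AE \<omega> in M. rdist a b \<omega> = rdist (x (s \<omega>)) b \<omega>"
  by (rule rdist_random_cong[where x = x and y = "\<lambda>_. b" and s = s and t = s, OF x b a eq b rdist_self[OF b]])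

section \<open>Random indices and their compositions\<close>

lemma random_indices_mono:
  assumes "random_indices M n" "\<omega> \<in> space M"
  shows "strict_mono (\<lambda>k. n k \<omega>)"
  using assms by (auto simp: random_indices_def strict_mono_Suc_iff)

lemma random_indices_measurable: "random_indices M n \<Longrightarrow> n k \<in> measurable M (count_space UNIV)"
  by (simp add: random_indices_def)

lemma random_indices_subseq:
  assumes n: "random_indices M n" and "strict_mono r"
  shows "random_indices M (\<lambda>k. n (r k))"
  unfolding random_indices_def
  using random_indices_mono[OF n] random_indices_measurable[OF n] assms(2)
  by (auto simp: strict_mono_def)

lemma random_indices_comp:
  assumes n: "random_indices M n" and m: "random_indices M m"
  shows "random_indices M (\<lambda>k \<omega>. n (m k \<omega>) \<omega>)"
proof -
  have [measurable]: "n k \<in> measurable M (count_space UNIV)" "m k \<in> measurable M (count_space UNIV)" for k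
    using n m by (simp_all add: random_indices_measurable)
  have "n (m k \<omega>) \<omega> < n (m (Suc k) \<omega>) \<omega>" if "\<omega> \<in> space M" for k \<omega>
    using random_indices_mono[OF n that] random_indices_mono[OF m that] by (simp add: strict_mono_def)
  then show ?thesis by (auto simp: random_indices_def)
qed

end

subsection \<open>Random compactness and continuity\<close>

locale RN_self_map = RN_module M E nrm
  for M :: "'w measure" and E :: "(('w \<Rightarrow> 'k::real_or_complex) set, 'e) module" and nrm +
  fixes G :: "'e set" and T :: "'e \<Rightarrow> 'e"
  assumes compact: "random_seq_compact M E nrm G"
    and convex: "L0_convex M E G"
    and stable: "sigma_stable_map M E G E G T"
    and continuous: "random_seq_continuous M E nrm G E nrm G T"
begin

lemma G_stable: "sigma_stable M E G" and G_nonempty: "G \<noteq> {}" and G_carrier: "x \<in> G \<Longrightarrow> x \<in> carrier E"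
  and T_closed: "x \<in> G \<Longrightarrow> T x \<in> G"
  using stable by (auto simp: sigma_stable_map_def sigma_stable_def)

lemmas G_simps [simp] = G_carrier T_closed

text \<open>Stability of \<open>T\<close> on the partition into levels of \<open>s\<close> says that
  \<open>T z\<close> is glued from the images of the pieces; uniqueness of concatenations identifies
  it pointwise.\<close>

lemma T_local:
  fixes s :: "'w \<Rightarrow> nat"
  assumes s: "s \<in> measurable M (count_space UNIV)" and x: "\<And>n. x n \<in> G" and z: "z \<in> G"
    and eq: "AE \<omega> in M. rdist z (x (s \<omega>)) \<omega> = 0"
  shows "AE \<omega> in M. rdist (T z) (T (x (s \<omega>))) \<omega> = 0"
proof -
  obtain z' where z': "z' \<in> G" "AE \<omega> in M. rdist z' (T (x (s \<omega>))) \<omega> = 0"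
    using sigma_stable_level[OF G_stable s, of "\<lambda>n. T (x n)"] x by auto
  have "T z = T (concatenation M E (level s) x)"
    using concatenation_level[OF s _ _ eq] x z by simp
  also have "\<dots> = concatenation M E (level s) (\<lambda>n. T (x n))"
    using stable x countable_partition_level[OF s] by (auto simp: sigma_stable_map_def image_subset_iff)
  also have "\<dots> = z'"
    using s x z' by (intro concatenation_level) auto
  finally show ?thesis using z' by simp
qed

text \<open>The terms are formed in the ambient \<open>H\<close>, but \<sigma>-stability of
  \<open>G\<close> supplies the same concatenations inside \<open>G\<close>, and these are
  unique.\<close>

lemma random_subsequenceD:
  assumes sub: "random_subsequence M E H x y" and x: "\<And>n. x n \<in> G"
  obtains n where "random_indices M n" "\<forall>k. y k \<in> G" "\<forall>k. AE \<omega> in M. rdist (y k) (x (n k \<omega>)) \<omega> = 0"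
proof -
  obtain n where n: "random_indices M n" and y: "\<And>k. y k = concatenation M E (level (n k)) x"
    using sub unfolding random_subsequence_def by blast
  have "y k \<in> G \<and> (AE \<omega> in M. rdist (y k) (x (n k \<omega>)) \<omega> = 0)" for k
  proof -
    note s = random_indices_measurable[OF n, of k]
    obtain z where z: "z \<in> G" "AE \<omega> in M. rdist z (x (n k \<omega>)) \<omega> = 0"
      using sigma_stable_level[OF G_stable s x] .
    then have "y k = z"
      unfolding y using s x by (intro concatenation_level) auto
    with z show ?thesis by simp
  qed
  with that n show thesis by blast
qed

text \<open>A deterministic subsequence of the random subsequence converges almost surely, and
  thinning random indices leaves random indices.\<close>

lemma random_compactness:
  assumes x: "\<And>n. x n \<in> G"
  obtains n z where "random_indices M n" "z \<in> G" "AE \<omega> in M. (\<lambda>k. rdist (x (n k \<omega>)) z \<omega>) \<longlonglongrightarrow> 0"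
proof -
  obtain H y z where sub: "random_subsequence M E H x y" and z: "z \<in> G"
    and lim: "limitin (eps_lambda_topology M E nrm) y z sequentially"
    using compact x unfolding random_seq_compact_def image_subset_iff by blast
  obtain n where n: "random_indices M n" and y: "\<forall>k. y k \<in> G"
    and eq: "\<forall>k. AE \<omega> in M. rdist (y k) (x (n k \<omega>)) \<omega> = 0"
    by (rule random_subsequenceD[OF sub x])
  obtain r where r: "strict_mono r" and ae: "AE \<omega> in M. (\<lambda>k. rdist (y (r k)) z \<omega>) \<longlonglongrightarrow> 0"
    using limitin_AE_subseq[OF lim] y by auto
  have "AE \<omega> in M. \<forall>k. rdist (y k) z \<omega> = rdist (x (n k \<omega>)) z \<omega>"
    unfolding AE_all_countable using x y z eq by (intro allI rdist_random_cong1) auto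
  with ae have "AE \<omega> in M. (\<lambda>k. rdist (x (n (r k) \<omega>)) z \<omega>) \<longlonglongrightarrow> 0"
    by eventually_elim simp
  with random_indices_subseq[OF n r] z that show thesis by blast
qed

text \<open>Continuity speaks of sequences in \<open>G\<close>, so the terms at the indices
  \<open>n k\<close> are first glued to elements \<open>a k\<close>. The random subsequence of
  \<open>a\<close> that it returns is unfolded to the composed indices of \<open>x\<close>.\<close>

lemma random_continuity:
  assumes x: "\<And>n. x n \<in> G" and n: "random_indices M n" and z: "z \<in> G"
    and lim: "AE \<omega> in M. (\<lambda>k. rdist (x (n k \<omega>)) z \<omega>) \<longlonglongrightarrow> 0"
  obtains m where "random_indices M m" "AE \<omega> in M. (\<lambda>k. rdist (T (x (n (m k \<omega>) \<omega>))) (T z) \<omega>) \<longlonglongrightarrow> 0"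
proof -
  have "\<exists>a\<in>G. AE \<omega> in M. rdist a (x (n k \<omega>)) \<omega> = 0" for k
    by (rule sigma_stable_level[where x = x and s = "n k", OF G_stable random_indices_measurable[OF n] x]) blast
  then obtain a where a: "\<And>k. a k \<in> G" and a_eq: "\<And>k. AE \<omega> in M. rdist (a k) (x (n k \<omega>)) \<omega> = 0"
    by metis
  have "AE \<omega> in M. \<forall>k. rdist (a k) z \<omega> = rdist (x (n k \<omega>)) z \<omega>"
    unfolding AE_all_countable using x a z a_eq by (intro allI rdist_random_cong1) auto
  with lim have "AE \<omega> in M. (\<lambda>k. rdist (a k) z \<omega>) \<longlonglongrightarrow> 0"
    by eventually_elim simp
  then have "limitin (eps_lambda_topology M E nrm) a z sequentially"
    using a z by (intro AE_limitin) auto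
  then obtain y where sub: "random_subsequence M E G a y"
    and lim: "limitin (eps_lambda_topology M E nrm) (\<lambda>k. T (y k)) (T z) sequentially"
    using continuous a z unfolding random_seq_continuous_def image_subset_iff by blast
  obtain m where m: "random_indices M m" and y: "\<forall>k. y k \<in> G"
    and eq: "\<forall>k. AE \<omega> in M. rdist (y k) (a (m k \<omega>)) \<omega> = 0"
    by (rule random_subsequenceD[OF sub a])
  obtain r where r: "strict_mono r" and ae: "AE \<omega> in M. (\<lambda>k. rdist (T (y (r k))) (T z) \<omega>) \<longlonglongrightarrow> 0"
    using limitin_AE_subseq[OF lim] y by auto
  have "AE \<omega> in M. \<forall>k. rdist (T (y k)) (T z) \<omega> = rdist (T (a (m k \<omega>))) (T z) \<omega>"
    unfolding AE_all_countable using a y z T_local[OF random_indices_measurable[OF m] a spec[OF y] spec[OF eq]]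
    by (intro allI rdist_random_cong1) auto
  \<comment> \<open>Stated for all \<open>j\<close> off one null set, so that the random value of
    the second index may be inserted for \<open>j\<close>.\<close>
  moreover have "AE \<omega> in M. \<forall>j. rdist (T (a j)) (T z) \<omega> = rdist (T (x (n j \<omega>))) (T z) \<omega>"
    unfolding AE_all_countable using x a z T_local[OF random_indices_measurable[OF n] x a a_eq]
    by (intro allI rdist_random_cong1[where x = "\<lambda>i. T (x i)"]) auto
  ultimately have "AE \<omega> in M. (\<lambda>k. rdist (T (x (n (m (r k) \<omega>) \<omega>))) (T z) \<omega>) \<longlonglongrightarrow> 0"
    using ae by eventually_elim simp
  with random_indices_subseq[OF m r] that show thesis by blast
qed

text \<open>The extractions are nested to end with common indices: first \<open>u\<close> converges,
  then \<open>T u\<close>, then \<open>w\<close> follows \<open>u\<close> along the same indices,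
  and a last extraction handles \<open>T w\<close>. Then the bound on the distance from
  \<open>u\<close> to \<open>T u\<close> tends to 0.\<close>

lemma fixed_point_of_approximation:
  assumes u: "\<And>k. u k \<in> G" and w: "\<And>k. w k \<in> G"
    and uw: "\<And>k. AE \<omega> in M. rdist (u k) (w k) \<omega> \<le> 1 / Suc k"
    and Tu: "\<And>k. AE \<omega> in M. rdist (u k) (T (u k)) \<omega> \<le> 1 / Suc k + rdist (T (u k)) (T (w k)) \<omega>"
  shows "\<exists>z\<in>G. T z = z"
proof -
  obtain n z where n: "random_indices M n" and z: "z \<in> G"
    and lim_u: "AE \<omega> in M. (\<lambda>k. rdist (u (n k \<omega>)) z \<omega>) \<longlonglongrightarrow> 0"
    by (rule random_compactness[OF u])
  obtain m where m: "random_indices M m"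
    and lim_Tu: "AE \<omega> in M. (\<lambda>k. rdist (T (u (n (m k \<omega>) \<omega>))) (T z) \<omega>) \<longlonglongrightarrow> 0"
    by (rule random_continuity[OF u n z lim_u])
  define n' where "n' = (\<lambda>k \<omega>. n (m k \<omega>) \<omega>)"
  have n': "random_indices M n'" unfolding n'_def by (rule random_indices_comp[OF n m])
  have uw': "AE \<omega> in M. \<forall>k. rdist (u k) (w k) \<omega> \<le> 1 / Suc k"
    and Tu': "AE \<omega> in M. \<forall>k. rdist (u k) (T (u k)) \<omega> \<le> 1 / Suc k + rdist (T (u k)) (T (w k)) \<omega>"
    using uw Tu by (auto simp: AE_all_countable)
  define S where "S = {z, T z} \<union> range u \<union> range w \<union> range (\<lambda>k. T (u k)) \<union> range (\<lambda>k. T (w k))"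
  have "countable S" "S \<subseteq> carrier E" using u w z by (auto simp: S_def)
  note metric = AE_rdist_metric[OF this]
  have S: "z \<in> S" "T z \<in> S" "u k \<in> S" "w k \<in> S" "T (u k) \<in> S" "T (w k) \<in> S" for k
    by (auto simp: S_def)
  have lim0: "(\<lambda>k. 1 / real (Suc (i k))) \<longlonglongrightarrow> 0" if "strict_mono i" for i
    using LIMSEQ_subseq_LIMSEQ[OF LIMSEQ_inverse_real_of_nat that] by (simp add: o_def inverse_eq_divide)
  have lim_w: "AE \<omega> in M. (\<lambda>k. rdist (w (n' k \<omega>)) z \<omega>) \<longlonglongrightarrow> 0"
    using metric lim_u uw' AE_space
  proof eventually_elim
    case (elim \<omega>)
    have lim: "(\<lambda>k. 1 / real (Suc (n' k \<omega>)) + rdist (u (n (m k \<omega>) \<omega>)) z \<omega>) \<longlonglongrightarrow> 0 + 0"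
      using lim0[OF random_indices_mono[OF n' elim(4)]]
        LIMSEQ_subseq_LIMSEQ[OF elim(2) random_indices_mono[OF m elim(4)]]
      by (intro tendsto_add) (auto simp: o_def)
    have le: "norm (rdist (w (n' k \<omega>)) z \<omega>) \<le> 1 / real (Suc (n' k \<omega>)) + rdist (u (n (m k \<omega>) \<omega>)) z \<omega>" for k
    proof -
      have "0 \<le> rdist (w (n' k \<omega>)) z \<omega>"
        "rdist (w (n' k \<omega>)) z \<omega> \<le> rdist (w (n' k \<omega>)) (u (n' k \<omega>)) \<omega> + rdist (u (n' k \<omega>)) z \<omega>"
        "rdist (w (n' k \<omega>)) (u (n' k \<omega>)) \<omega> = rdist (u (n' k \<omega>)) (w (n' k \<omega>)) \<omega>"
        using elim(1) S by blast+
      moreover have "rdist (u (n' k \<omega>)) (w (n' k \<omega>)) \<omega> \<le> 1 / real (Suc (n' k \<omega>))"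
        using elim(3) by blast
      ultimately show ?thesis by (simp add: n'_def)
    qed
    show ?case
      by (rule Lim_null_comparison[OF always_eventually[OF allI[OF le]]]) (use lim in simp)
  qed
  obtain m' where m': "random_indices M m'"
    and lim_Tw: "AE \<omega> in M. (\<lambda>k. rdist (T (w (n' (m' k \<omega>) \<omega>))) (T z) \<omega>) \<longlonglongrightarrow> 0"
    by (rule random_continuity[OF w n' z lim_w])
  have "AE \<omega> in M. rdist (T z) z \<omega> = 0"
    using metric lim_u lim_Tu lim_Tw Tu' AE_space
  proof eventually_elim
    case (elim \<omega>)
    define i where "i k = n' (m' k \<omega>) \<omega>" for k
    have i: "strict_mono i"
      unfolding i_def using random_indices_mono[OF random_indices_comp[OF n' m'] elim(6)] .
    have "strict_mono (\<lambda>k. m (m' k \<omega>) \<omega>)"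
      by (rule random_indices_mono[OF random_indices_comp[OF m m'] elim(6)])
    from LIMSEQ_subseq_LIMSEQ[OF elim(2) this] have 1: "(\<lambda>k. rdist (u (i k)) z \<omega>) \<longlonglongrightarrow> 0"
      by (simp add: o_def i_def n'_def)
    from LIMSEQ_subseq_LIMSEQ[OF elim(3) random_indices_mono[OF m' elim(6)]]
    have 2: "(\<lambda>k. rdist (T (u (i k))) (T z) \<omega>) \<longlonglongrightarrow> 0"
      by (simp add: o_def i_def n'_def)
    have 3: "(\<lambda>k. rdist (T (w (i k))) (T z) \<omega>) \<longlonglongrightarrow> 0" using elim(4) by (simp add: i_def)
    \<comment> \<open>The distance from \<open>T u\<close> to \<open>T z\<close> enters twice: in
      the path from \<open>T z\<close> to \<open>z\<close>, and when the distance from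
      \<open>T u\<close> to \<open>T w\<close> is estimated through \<open>T z\<close>.\<close>
    have "(\<lambda>k. 1 / real (Suc (i k)) + 2 * rdist (T (u (i k))) (T z) \<omega> + rdist (T (w (i k))) (T z) \<omega>
        + rdist (u (i k)) z \<omega>) \<longlonglongrightarrow> 0 + 2 * 0 + 0 + 0"
      by (intro tendsto_intros lim0 i 1 2 3)
    moreover have "rdist (T z) z \<omega> \<le> 1 / real (Suc (i k)) + 2 * rdist (T (u (i k))) (T z) \<omega>
        + rdist (T (w (i k))) (T z) \<omega> + rdist (u (i k)) z \<omega>" for k
    proof -
      have "rdist (T z) z \<omega> \<le> rdist (T z) (T (u (i k))) \<omega> + rdist (T (u (i k))) z \<omega>"
        "rdist (T (u (i k))) z \<omega> \<le> rdist (T (u (i k))) (u (i k)) \<omega> + rdist (u (i k)) z \<omega>"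
        "rdist (T z) (T (u (i k))) \<omega> = rdist (T (u (i k))) (T z) \<omega>"
        "rdist (T (u (i k))) (u (i k)) \<omega> = rdist (u (i k)) (T (u (i k))) \<omega>"
        "rdist (T (u (i k))) (T (w (i k))) \<omega> \<le> rdist (T (u (i k))) (T z) \<omega> + rdist (T z) (T (w (i k))) \<omega>"
        "rdist (T z) (T (w (i k))) \<omega> = rdist (T (w (i k))) (T z) \<omega>"
        using elim(1) S by blast+
      moreover have "rdist (u (i k)) (T (u (i k))) \<omega> \<le> 1 / Suc (i k) + rdist (T (u (i k))) (T (w (i k))) \<omega>"
        using elim(5) by blast
      ultimately show ?thesis by linarith
    qed
    ultimately have "rdist (T z) z \<omega> \<le> 0"
      by (intro LIMSEQ_le_const) auto
    moreover have "0 \<le> rdist (T z) z \<omega>" using elim(1) S by blast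
    ultimately show ?case by simp
  qed
  then have "T z = z" using z by (intro rdist_eq_zeroD) auto
  with z show ?thesis by blast
qed

end

subsection \<open>Approximate fixed points\<close>

text \<open>Uniting near-maximisers gives a countable subfamily whose union has the largest measure
  possible. Adding any further \<open>F i\<close> cannot increase it, so \<open>F i\<close> exceeds
  the union by a null set only.\<close>

lemma (in finite_measure) essential_union:
  assumes I: "I \<noteq> {}" and F: "\<And>i. i \<in> I \<Longrightarrow> F i \<in> sets M"
  obtains j :: "nat \<Rightarrow> 'i" where "\<forall>k. j k \<in> I" "\<forall>i\<in>I. AE \<omega> in M. \<omega> \<in> F i \<longrightarrow> (\<exists>k. \<omega> \<in> F (j k))"
proof -
  define \<J> where "\<J> = {J. J \<subseteq> I \<and> countable J}"
  define m where "m J = measure M (\<Union>i\<in>J. F i)" for J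
  define S where "S = (SUP J\<in>\<J>. m J)"
  have sets: "(\<Union>i\<in>J. F i) \<in> sets M" if "J \<in> \<J>" for J
    using that F by (auto simp: \<J>_def)
  have bdd: "bdd_above (m ` \<J>)"
    by (rule bdd_aboveI[of _ "measure M (space M)"]) (auto simp: m_def bounded_measure)
  have "{} \<in> \<J>" by (simp add: \<J>_def)
  have "\<exists>J\<in>\<J>. S - 1 / Suc n < m J" for n
    using \<open>{} \<in> \<J>\<close> bdd less_cSUP_iff[of \<J> m "S - 1 / Suc n"] by (auto simp: S_def)
  then obtain J where J: "\<And>n. J n \<in> \<J>" "\<And>n. S - 1 / Suc n < m (J n)" by metis
  obtain i0 where i0: "i0 \<in> I" using I by blast
  \<comment> \<open>The extra \<open>i0\<close> makes \<open>K\<close> nonempty, so that it can be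
    enumerated by the natural numbers.\<close>
  define K where "K = insert i0 (\<Union>n. J n)"
  have K: "K \<in> \<J>" using J(1) i0 by (auto simp: K_def \<J>_def)
  have "S \<le> m K"
  proof (rule field_le_epsilon)
    fix e :: real assume "0 < e"
    then obtain n where n: "1 / Suc n < e" using reals_Archimedean by (auto simp: inverse_eq_divide)
    have "m (J n) \<le> m K"
      unfolding m_def using sets[OF K] by (intro finite_measure_mono) (auto simp: K_def)
    with J(2)[of n] n show "S \<le> m K + e" by linarith
  qed
  have cover: "AE \<omega> in M. \<omega> \<in> F i \<longrightarrow> (\<exists>k\<in>K. \<omega> \<in> F k)" if i: "i \<in> I" for i
  proof -
    let ?U = "\<Union>k\<in>K. F k"
    have iK: "insert i K \<in> \<J>" using i K by (auto simp: \<J>_def)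
    have "m (insert i K) \<le> S"
      unfolding S_def using iK bdd by (rule cSUP_upper)
    also note \<open>S \<le> m K\<close>
    also have "m (insert i K) = m K + measure M (F i - ?U)"
    proof -
      have eq: "(\<Union>k\<in>insert i K. F k) = ?U \<union> (F i - ?U)" by auto
      show ?thesis
        unfolding m_def eq using sets[OF K] F[OF i] by (intro finite_measure_Union) auto
    qed
    finally have "measure M (F i - ?U) = 0" using measure_nonneg[of M "F i - ?U"] by linarith
    then have "AE \<omega> in M. \<omega> \<notin> F i - ?U"
      using sets[OF K] F[OF i] by (intro AE_not_in) (auto simp: null_sets_def emeasure_eq_measure)
    then show ?thesis by eventually_elim auto
  qed
  have range: "range (from_nat_into K) = K"
    using K i0 by (intro range_from_nat_into) (auto simp: K_def \<J>_def)
  show thesis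
  proof (rule that[of "from_nat_into K"]; intro allI ballI)
    show "from_nat_into K k \<in> I" for k
      using range K unfolding \<J>_def by blast
    show "AE \<omega> in M. \<omega> \<in> F i \<longrightarrow> (\<exists>k. \<omega> \<in> F (from_nat_into K k))" if "i \<in> I" for i
      using cover[OF that] by eventually_elim (metis range imageE)
  qed
qed

section \<open>Gluing local approximations\<close>

context RN_self_map
begin

text \<open>The term \<open>rdist (T u) (T w)\<close> stays in the bound: closeness of
  \<open>u\<close> and \<open>w\<close> gives no uniform control of it, and it is disposed of only
  in the limit \<epsilon> \<rightarrow> 0.\<close>

definition nearly_fixed :: "real \<Rightarrow> 'w set \<Rightarrow> bool" where
  "nearly_fixed \<epsilon> A \<longleftrightarrow> (\<exists>u\<in>G. \<exists>w\<in>G. AE \<omega> in M. \<omega> \<in> A \<longrightarrow>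
     rdist u w \<omega> \<le> \<epsilon> \<and> rdist u (T u) \<omega> \<le> \<epsilon> + rdist (T u) (T w) \<omega>)"

lemma glue_least:
  fixes B :: "nat \<Rightarrow> 'w set"
  assumes B: "\<And>k. B k \<in> sets M" and cover: "AE \<omega> in M. \<omega> \<in> A \<longrightarrow> (\<exists>k. \<omega> \<in> B k)"
  obtains s where "s \<in> measurable M (count_space UNIV)" "AE \<omega> in M. \<omega> \<in> A \<longrightarrow> \<omega> \<in> B (s \<omega>)"
proof
  show "(\<lambda>\<omega>. LEAST k. \<omega> \<in> B k) \<in> measurable M (count_space UNIV)"
  proof (rule measurable_Least)
    show "Measurable.pred M (\<lambda>\<omega>. \<omega> \<in> B k)" for k
      using B[of k] by measurable
  qed
  show "AE \<omega> in M. \<omega> \<in> A \<longrightarrow> \<omega> \<in> B (LEAST k. \<omega> \<in> B k)"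
    using cover by eventually_elim (metis (mono_tags, lifting) LeastI)
qed

text \<open>One pair is chosen for each piece, and the pairs are glued along the first piece
  containing \<omega>. By locality of \<open>T\<close> the inequalities carry over to the glued
  pair.\<close>

lemma nearly_fixed_UN:
  assumes I: "countable I" and B: "\<And>i. i \<in> I \<Longrightarrow> B i \<in> sets M"
    and near: "\<And>i. i \<in> I \<Longrightarrow> nearly_fixed \<epsilon> (B i)"
    and cover: "AE \<omega> in M. \<omega> \<in> A \<longrightarrow> (\<exists>i\<in>I. \<omega> \<in> B i)"
  shows "nearly_fixed \<epsilon> A"
proof (cases "I = {}")
  \<comment> \<open>Without pieces the cover makes \<open>A\<close> null, and any point of
    \<open>G\<close> serves.\<close>
  case True
  obtain a where "a \<in> G" using G_nonempty by blast
  then show ?thesis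
    using cover True unfolding nearly_fixed_def by (intro bexI[of _ a]) (auto elim: eventually_mono)
next
  case False
  define i where "i = from_nat_into I"
  have i: "i k \<in> I" for k using False by (simp add: i_def from_nat_into)
  have range_i: "range i = I" unfolding i_def using False I by (rule range_from_nat_into)
  define Q where "Q k u w \<longleftrightarrow> u \<in> G \<and> w \<in> G \<and> (AE \<omega> in M. \<omega> \<in> B (i k) \<longrightarrow>
     rdist u w \<omega> \<le> \<epsilon> \<and> rdist u (T u) \<omega> \<le> \<epsilon> + rdist (T u) (T w) \<omega>)" for k u w
  have "\<exists>u w. Q k u w" for k
    using near[OF i] unfolding nearly_fixed_def Q_def by blast
  then obtain u w where Q: "\<And>k. Q k (u k) (w k)" by metis
  then have u: "\<And>k. u k \<in> G" and w: "\<And>k. w k \<in> G"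
    and uw: "\<And>k. AE \<omega> in M. \<omega> \<in> B (i k) \<longrightarrow>
     rdist (u k) (w k) \<omega> \<le> \<epsilon> \<and> rdist (u k) (T (u k)) \<omega> \<le> \<epsilon> + rdist (T (u k)) (T (w k)) \<omega>"
    unfolding Q_def by blast+
  have cover_i: "AE \<omega> in M. \<omega> \<in> A \<longrightarrow> (\<exists>k. \<omega> \<in> B (i k))"
    using cover by eventually_elim (metis range_i imageE)
  obtain s where s: "s \<in> measurable M (count_space UNIV)" and sA: "AE \<omega> in M. \<omega> \<in> A \<longrightarrow> \<omega> \<in> B (i (s \<omega>))"
    by (rule glue_least[OF B[OF i] cover_i])
  obtain p where p: "p \<in> G" "AE \<omega> in M. rdist p (u (s \<omega>)) \<omega> = 0"
    by (rule sigma_stable_level[where x = u and s = s, OF G_stable s u])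
  obtain q where q: "q \<in> G" "AE \<omega> in M. rdist q (w (s \<omega>)) \<omega> = 0"
    by (rule sigma_stable_level[where x = w and s = s, OF G_stable s w])
  note Tp = T_local[OF s u p] and Tq = T_local[OF s w q]
  have "AE \<omega> in M. rdist p q \<omega> = rdist (u (s \<omega>)) (w (s \<omega>)) \<omega>"
    using u w p q by (intro rdist_random_cong) auto
  moreover have "AE \<omega> in M. rdist p (T p) \<omega> = rdist (u (s \<omega>)) (T (u (s \<omega>))) \<omega>"
    using u p Tp by (intro rdist_random_cong[where y = "\<lambda>k. T (u k)"]) auto
  moreover have "AE \<omega> in M. rdist (T p) (T q) \<omega> = rdist (T (u (s \<omega>))) (T (w (s \<omega>))) \<omega>"
    using u w p q Tp Tq
    by (intro rdist_random_cong[where x = "\<lambda>k. T (u k)" and y = "\<lambda>k. T (w k)"]) auto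
  moreover have "AE \<omega> in M. \<forall>k. \<omega> \<in> B (i k) \<longrightarrow>
     rdist (u k) (w k) \<omega> \<le> \<epsilon> \<and> rdist (u k) (T (u k)) \<omega> \<le> \<epsilon> + rdist (T (u k)) (T (w k)) \<omega>"
    unfolding AE_all_countable using uw by blast
  ultimately have "AE \<omega> in M. \<omega> \<in> A \<longrightarrow>
     rdist p q \<omega> \<le> \<epsilon> \<and> rdist p (T p) \<omega> \<le> \<epsilon> + rdist (T p) (T q) \<omega>"
    using sA by eventually_elim simp
  with p q show ?thesis unfolding nearly_fixed_def by blast
qed

text \<open>Let \<open>F y\<close> be the event that \<open>y\<close> keeps distance \<epsilon> from
  the given points. Countably many \<open>F (j k)\<close> essentially cover all of them, and gluing
  the \<open>j k\<close> gives an \<open>a\<close> that is separated almost everywhere any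
  \<open>y\<close> is.\<close>

lemma maximal_separated:
  fixes x :: "nat \<Rightarrow> 'e"
  assumes x: "\<And>i. i < n \<Longrightarrow> x i \<in> G"
  shows "\<exists>a\<in>G. \<forall>y\<in>G. AE \<omega> in M. (\<forall>i<n. \<epsilon> \<le> rdist y (x i) \<omega>) \<longrightarrow> (\<forall>i<n. \<epsilon> \<le> rdist a (x i) \<omega>)"
proof -
  define F where "F y = {\<omega> \<in> space M. \<forall>i<n. \<epsilon> \<le> rdist y (x i) \<omega>}" for y
  have F: "F y \<in> sets M" if "y \<in> G" for y
  proof -
    have [measurable]: "rdist y (x i) \<in> borel_measurable M" if "i < n" for i using that \<open>y \<in> G\<close> x by simp
    have "F y = space M \<inter> (\<Inter>i\<in>{..<n}. {\<omega> \<in> space M. \<epsilon> \<le> rdist y (x i) \<omega>})"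
      by (auto simp: F_def)
    also have "\<dots> \<in> sets M"
    proof (cases "n = 0")
      case False
      then show ?thesis by (intro sets.Int sets.finite_INT) auto
    qed simp
    finally show ?thesis .
  qed
  obtain j :: "nat \<Rightarrow> 'e" where j: "\<forall>k. j k \<in> G"
    and max: "\<forall>y\<in>G. AE \<omega> in M. \<omega> \<in> F y \<longrightarrow> (\<exists>k. \<omega> \<in> F (j k))"
    by (rule essential_union[OF G_nonempty F])
  have cover: "AE \<omega> in M. \<omega> \<in> (\<Union>k. F (j k)) \<longrightarrow> (\<exists>k. \<omega> \<in> F (j k))" by simp
  obtain s where s: "s \<in> measurable M (count_space UNIV)"
    and sA: "AE \<omega> in M. \<omega> \<in> (\<Union>k. F (j k)) \<longrightarrow> \<omega> \<in> F (j (s \<omega>))"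
    by (rule glue_least[OF F[OF spec[OF j]] cover])
  obtain a where a: "a \<in> G" "AE \<omega> in M. rdist a (j (s \<omega>)) \<omega> = 0"
    by (rule sigma_stable_level[where x = j and s = s, OF G_stable s spec[OF j]])
  have "AE \<omega> in M. \<forall>i\<in>{..<n}. rdist a (x i) \<omega> = rdist (j (s \<omega>)) (x i) \<omega>"
    using a j x by (intro AE_ball_countable[THEN iffD2] ballI rdist_random_cong1) auto
  then have sA: "AE \<omega> in M. \<omega> \<in> (\<Union>k. F (j k)) \<longrightarrow> (\<forall>i<n. \<epsilon> \<le> rdist a (x i) \<omega>)"
    using sA by eventually_elim (auto simp: F_def)
  have "AE \<omega> in M. (\<forall>i<n. \<epsilon> \<le> rdist y (x i) \<omega>) \<longrightarrow> (\<forall>i<n. \<epsilon> \<le> rdist a (x i) \<omega>)" if "y \<in> G" for y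
    using bspec[OF max that] sA AE_space by eventually_elim (auto simp: F_def)
  with a show ?thesis by blast
qed

text \<open>Choose each \<open>x n\<close> as separated as possible from its predecessors. Where
  \<open>x n\<close> is nevertheless close to one of them, maximality makes every \<open>y\<close>
  close to one; this event is \<open>C n\<close>. Outside all \<open>C n\<close> the sequence would
  be \<epsilon>-separated, against random compactness.\<close>

lemma random_total_boundedness:
  assumes \<epsilon>: "0 < \<epsilon>"
  obtains x :: "nat \<Rightarrow> 'e" and C where "\<forall>n. x n \<in> G" "\<forall>n. C n \<in> sets M" "AE \<omega> in M. \<exists>n. \<omega> \<in> C n"
    "\<forall>n. \<forall>y\<in>G. AE \<omega> in M. \<omega> \<in> C n \<longrightarrow> (\<exists>i<n. rdist y (x i) \<omega> < \<epsilon>)"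
proof -
  have "\<exists>x :: nat \<Rightarrow> 'e. \<forall>n. x n \<in> G \<and> (\<forall>y\<in>G. AE \<omega> in M. (\<forall>i<n. \<epsilon> \<le> rdist y (x i) \<omega>) \<longrightarrow> (\<forall>i<n. \<epsilon> \<le> rdist (x n) (x i) \<omega>))"
  proof (rule dependent_wellorder_choice[where P = "\<lambda>f (n::nat) r. r \<in> G \<and>
      (\<forall>y\<in>G. AE \<omega> in M. (\<forall>i<n. \<epsilon> \<le> rdist y (f i) \<omega>) \<longrightarrow> (\<forall>i<n. \<epsilon> \<le> rdist r (f i) \<omega>))"])
    fix r :: 'e and f g :: "nat \<Rightarrow> 'e" and n assume eq: "\<And>i. i < n \<Longrightarrow> f i = g i"
    then have "(\<forall>i<n. \<epsilon> \<le> rdist y (f i) \<omega>) \<longleftrightarrow> (\<forall>i<n. \<epsilon> \<le> rdist y (g i) \<omega>)" for y \<omega>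
      by simp
    then show "(r \<in> G \<and> (\<forall>y\<in>G. AE \<omega> in M. (\<forall>i<n. \<epsilon> \<le> rdist y (f i) \<omega>) \<longrightarrow> (\<forall>i<n. \<epsilon> \<le> rdist r (f i) \<omega>))) =
      (r \<in> G \<and> (\<forall>y\<in>G. AE \<omega> in M. (\<forall>i<n. \<epsilon> \<le> rdist y (g i) \<omega>) \<longrightarrow> (\<forall>i<n. \<epsilon> \<le> rdist r (g i) \<omega>)))"
      by simp
  next
    fix n and f :: "nat \<Rightarrow> 'e"
    assume "\<And>i. i < n \<Longrightarrow> f i \<in> G \<and> (\<forall>y\<in>G. AE \<omega> in M. (\<forall>l<i. \<epsilon> \<le> rdist y (f l) \<omega>) \<longrightarrow> (\<forall>l<i. \<epsilon> \<le> rdist (f i) (f l) \<omega>))"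
    then show "\<exists>r. r \<in> G \<and> (\<forall>y\<in>G. AE \<omega> in M. (\<forall>i<n. \<epsilon> \<le> rdist y (f i) \<omega>) \<longrightarrow> (\<forall>i<n. \<epsilon> \<le> rdist r (f i) \<omega>))"
      using maximal_separated[of n f \<epsilon>] by blast
  qed
  then obtain x :: "nat \<Rightarrow> 'e" where X: "\<forall>n. x n \<in> G \<and> (\<forall>y\<in>G.
      AE \<omega> in M. (\<forall>i<n. \<epsilon> \<le> rdist y (x i) \<omega>) \<longrightarrow> (\<forall>i<n. \<epsilon> \<le> rdist (x n) (x i) \<omega>))" ..
  have x: "x n \<in> G" for n using X by blast
  have max: "AE \<omega> in M. (\<forall>i<n. \<epsilon> \<le> rdist y (x i) \<omega>) \<longrightarrow> (\<forall>i<n. \<epsilon> \<le> rdist (x n) (x i) \<omega>)"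
    if "y \<in> G" for n y
    using X that by blast
  define C where "C n = {\<omega> \<in> space M. \<exists>i<n. rdist (x n) (x i) \<omega> < \<epsilon>}" for n
  have [measurable]: "rdist (x n) (x i) \<in> borel_measurable M" for n i using x by simp
  have C: "C n \<in> sets M" for n unfolding C_def by measurable
  obtain n z where n: "random_indices M n" and z: "z \<in> G"
    and lim: "AE \<omega> in M. (\<lambda>k. rdist (x (n k \<omega>)) z \<omega>) \<longlonglongrightarrow> 0"
    by (rule random_compactness[OF x])
  define S where "S = insert z (range x)"
  have S: "z \<in> S" "x n \<in> S" for n by (auto simp: S_def)
  have "countable S" "S \<subseteq> carrier E" using x z by (auto simp: S_def)
  note metric = AE_rdist_metric[OF this]
  have "AE \<omega> in M. \<exists>n. \<omega> \<in> C n"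
    using metric lim AE_space
  proof eventually_elim
    case (elim \<omega>)
    have "\<forall>\<^sub>F k in sequentially. rdist (x (n k \<omega>)) z \<omega> < \<epsilon> / 2"
      using elim(2) \<epsilon> by (intro order_tendstoD) auto
    \<comment> \<open>Two successive terms near the limit are near each other, which puts \<omega>
      into \<open>C\<close> at the larger index \<open>n (Suc k) \<omega>\<close>.\<close>
    then obtain k where k: "rdist (x (n k \<omega>)) z \<omega> < \<epsilon> / 2" "rdist (x (n (Suc k) \<omega>)) z \<omega> < \<epsilon> / 2"
      unfolding eventually_sequentially by (meson le_refl le_SucI)
    have "rdist (x (n (Suc k) \<omega>)) (x (n k \<omega>)) \<omega> \<le> rdist (x (n (Suc k) \<omega>)) z \<omega> + rdist z (x (n k \<omega>)) \<omega>"
      "rdist z (x (n k \<omega>)) \<omega> = rdist (x (n k \<omega>)) z \<omega>"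
      using elim(1) S by blast+
    with k have "rdist (x (n (Suc k) \<omega>)) (x (n k \<omega>)) \<omega> < \<epsilon>" by linarith
    moreover have "n k \<omega> < n (Suc k) \<omega>" using n elim(3) by (simp add: random_indices_def)
    ultimately show ?case using elim(3) by (auto simp: C_def)
  qed
  moreover have "AE \<omega> in M. \<omega> \<in> C n \<longrightarrow> (\<exists>i<n. rdist y (x i) \<omega> < \<epsilon>)" if "y \<in> G" for y n
    using max[OF that, of n]
  proof eventually_elim
    case (elim \<omega>)
    then show ?case unfolding C_def mem_Collect_eq not_le[symmetric] by blast
  qed
  ultimately show thesis using x C by (intro that[of x C]) blast+
qed

text \<open>The weights \<open>c\<close> are the image of \<open>t\<close> under \<open>j\<close>,
  so the distance from \<open>X c\<close> to \<open>T (X c)\<close> is at most the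
  \<open>t\<close>-average of the distances from \<open>x (j v)\<close> to \<open>T (X c)\<close>.
  Each label lies within \<epsilon> of \<open>T (X v)\<close>, which leaves the largest distance
  from \<open>T (X c)\<close> to a \<open>T (X v)\<close>.\<close>

lemma nearly_fixed_labelled:
  assumes \<epsilon>: "0 < \<epsilon>" and x: "\<And>i. x i \<in> G" and [measurable]: "A \<in> sets M"
    and V: "finite V" "V \<subseteq> std_simplex n"
    and c: "c \<in> std_simplex n" "\<And>i. c i = (\<Sum>v\<in>V. if j v = i then t v else 0)"
    and j: "j ` V \<subseteq> {..<n}"
    and t: "\<And>v. v \<in> V \<Longrightarrow> 0 \<le> t v" "sum t V = 1"
    and close: "\<And>v i. \<lbrakk>v \<in> V; 0 < t v\<rbrakk> \<Longrightarrow> \<bar>v i - c i\<bar> \<le> \<delta>"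
    and \<delta>: "AE \<omega> in M. \<omega> \<in> A \<longrightarrow> \<delta> * (\<Sum>i<n. rnorm (x i) \<omega>) \<le> \<epsilon>"
    and lab: "\<And>v. v \<in> V \<Longrightarrow> AE \<omega> in M. \<omega> \<in> A \<longrightarrow> rdist (T (comb n v x)) (x (j v)) \<omega> < \<epsilon>"
  shows "nearly_fixed \<epsilon> A"
proof -
  define X where "X v = comb n v x" for v
  define W where "W = {v\<in>V. 0 < t v}"
  have X: "X v \<in> G" if "v \<in> std_simplex n" for v
    unfolding X_def using that convex x by (intro comb_in_convex) (auto simp: std_simplex_def)
  then have XV: "X v \<in> G" if "v \<in> V" for v using that V by blast
  have Xc: "X c \<in> G" using X c by blast
  have xE: "x i \<in> carrier E" for i using x by simp
  \<comment> \<open>The maximiser depends on \<omega>, so \<open>A\<close> is split by it. Only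
    \<open>v\<close> of positive weight compete, since these are the ones close to
    \<open>c\<close>.\<close>
  define B where "B v = {\<omega>\<in>A. \<forall>v'\<in>W. rdist (T (X c)) (T (X v')) \<omega> \<le> rdist (T (X c)) (T (X v)) \<omega>}" for v
  have finW: "finite W" and WV: "W \<subseteq> V" using V by (auto simp: W_def)
  have neW: "W \<noteq> {}"
  proof
    assume "W = {}"
    then have "sum t V = 0" using t(1) by (intro sum.neutral) (force simp: W_def)
    with t show False by simp
  qed
  show ?thesis
  proof (rule nearly_fixed_UN[where I = W and B = B])
    show "countable W" using finW by (rule countable_finite)
    show "B v \<in> sets M" if "v \<in> W" for v
    proof -
      have "B v = A \<inter> (\<Inter>v'\<in>W. {\<omega>\<in>space M. rdist (T (X c)) (T (X v')) \<omega> \<le> rdist (T (X c)) (T (X v)) \<omega>})"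
        using neW sets.sets_into_space[OF \<open>A \<in> sets M\<close>] by (auto simp: B_def)
      also have "\<dots> \<in> sets M"
      proof (intro sets.Int sets.finite_INT finW neW \<open>A \<in> sets M\<close>)
        fix v' assume "v' \<in> W"
        then have [measurable]: "rdist (T (X c)) (T (X v')) \<in> borel_measurable M"
          "rdist (T (X c)) (T (X v)) \<in> borel_measurable M"
          using WV that XV Xc by auto
        show "{\<omega> \<in> space M. rdist (T (X c)) (T (X v')) \<omega> \<le> rdist (T (X c)) (T (X v)) \<omega>} \<in> sets M"
          by measurable
      qed
      finally show ?thesis .
    qed
    show "AE \<omega> in M. \<omega> \<in> A \<longrightarrow> (\<exists>v\<in>W. \<omega> \<in> B v)"
    proof (intro AE_I2 impI)
      fix \<omega> assume "\<omega> \<in> A"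
      let ?f = "\<lambda>v. rdist (T (X c)) (T (X v)) \<omega>"
      have "Max (?f ` W) \<in> ?f ` W" using finW neW by (intro Max_in) auto
      then obtain v where v: "v \<in> W" "Max (?f ` W) = ?f v" by (rule imageE)
      have "?f v' \<le> ?f v" if "v' \<in> W" for v'
        unfolding v(2)[symmetric] using finW that by (intro Max_ge) auto
      with v(1) \<open>\<omega> \<in> A\<close> show "\<exists>v\<in>W. \<omega> \<in> B v" unfolding B_def by blast
    qed
    fix v0 assume v0: "v0 \<in> W"
    have 1: "AE \<omega> in M. rdist (X c) (X v0) \<omega> \<le> (\<Sum>i<n. \<bar>c i - v0 i\<bar> * rnorm (x i) \<omega>)"
      unfolding X_def by (rule rdist_comb_comb[OF xE])
    have 2: "AE \<omega> in M. rdist (X c) (T (X c)) \<omega> \<le> (\<Sum>i<n. \<bar>c i\<bar> * rdist (x i) (T (X c)) \<omega>)"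
      unfolding X_def using c(1) Xc by (intro rdist_comb[OF xE]) (auto simp: std_simplex_def X_def)
    have 3: "AE \<omega> in M. \<forall>i\<in>{..<n}. 0 \<le> rnorm (x i) \<omega>"
      using xE by (intro AE_ball_countable[THEN iffD2] ballI rnorm_nonneg) auto
    have 4: "AE \<omega> in M. \<forall>v\<in>V. \<omega> \<in> A \<longrightarrow> rdist (T (X v)) (x (j v)) \<omega> < \<epsilon>"
      using lab V(1) unfolding X_def by (intro AE_ball_countable[THEN iffD2] ballI countable_finite) auto
    define S where "S = insert (T (X c)) (range x \<union> (\<lambda>v. T (X v)) ` V)"
    have S': "T (X c) \<in> S" "x i \<in> S" "v \<in> V \<Longrightarrow> T (X v) \<in> S" for i v
      by (auto simp: S_def)
    have S: "countable S" "S \<subseteq> carrier E"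
      using x XV Xc V(1) by (auto simp: S_def countable_finite)
    show "nearly_fixed \<epsilon> (B v0)"
      unfolding nearly_fixed_def
    proof (rule bexI[of _ "X c"], rule bexI[of _ "X v0"])
      show "AE \<omega> in M. \<omega> \<in> B v0 \<longrightarrow> rdist (X c) (X v0) \<omega> \<le> \<epsilon> \<and>
          rdist (X c) (T (X c)) \<omega> \<le> \<epsilon> + rdist (T (X c)) (T (X v0)) \<omega>"
        using 1 2 3 4 \<delta> AE_rdist_metric[OF S]
      proof eventually_elim
        case (elim \<omega>)
        show ?case
        proof
          assume "\<omega> \<in> B v0"
          then have A: "\<omega> \<in> A" and max: "\<And>v. v \<in> W \<Longrightarrow> rdist (T (X c)) (T (X v)) \<omega> \<le> rdist (T (X c)) (T (X v0)) \<omega>"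
            by (auto simp: B_def)
          have "rdist (X c) (X v0) \<omega> \<le> (\<Sum>i<n. \<delta> * rnorm (x i) \<omega>)"
            using elim(3) close[of v0] v0
            by (intro order.trans[OF elim(1)] sum_mono mult_right_mono) (auto simp: W_def abs_minus_commute)
          also have "\<dots> \<le> \<epsilon>" using elim(5) A by (simp add: sum_distrib_left)
          finally have "rdist (X c) (X v0) \<omega> \<le> \<epsilon>" .
          moreover have "rdist (X c) (T (X c)) \<omega> \<le> \<epsilon> + rdist (T (X c)) (T (X v0)) \<omega>" (is "_ \<le> ?b")
          proof -
            have "rdist (X c) (T (X c)) \<omega> \<le> (\<Sum>i<n. c i * rdist (x i) (T (X c)) \<omega>)"
              using elim(2) c(1) by (auto simp: std_simplex_def)
            also have "\<dots> = (\<Sum>v\<in>V. t v * rdist (x (j v)) (T (X c)) \<omega>)"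
              unfolding c(2) by (rule sum_over_fibres[OF V(1) j])
            also have "\<dots> \<le> (\<Sum>v\<in>V. t v * ?b)"
            proof (rule sum_mono)
              fix v assume v: "v \<in> V"
              show "t v * rdist (x (j v)) (T (X c)) \<omega> \<le> t v * ?b"
              \<comment> \<open>Indices of weight zero are outside the maximum but contribute
                nothing to the average.\<close>
              proof (cases "0 < t v")
                case True
                have "rdist (x (j v)) (T (X c)) \<omega> \<le> rdist (x (j v)) (T (X v)) \<omega> + rdist (T (X v)) (T (X c)) \<omega>"
                  "rdist (x (j v)) (T (X v)) \<omega> = rdist (T (X v)) (x (j v)) \<omega>"
                  "rdist (T (X v)) (T (X c)) \<omega> = rdist (T (X c)) (T (X v)) \<omega>"
                  using elim(6) S' v by blast+
                moreover have "rdist (T (X v)) (x (j v)) \<omega> < \<epsilon>" using elim(4) A v by blast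
                moreover have "rdist (T (X c)) (T (X v)) \<omega> \<le> rdist (T (X c)) (T (X v0)) \<omega>"
                  using max v True by (simp add: W_def)
                ultimately have "rdist (x (j v)) (T (X c)) \<omega> \<le> ?b" by linarith
                with True show ?thesis by simp
              qed (use t(1)[OF v] in simp)
            qed
            also have "\<dots> = ?b" using t(2) by (simp add: sum_distrib_right[symmetric])
            finally show ?thesis .
          qed
          ultimately show "rdist (X c) (X v0) \<omega> \<le> \<epsilon> \<and>
            rdist (X c) (T (X c)) \<omega> \<le> \<epsilon> + rdist (T (X c)) (T (X v0)) \<omega>" by blast
        qed
      qed
    qed (use Xc XV v0 WV in auto)
  qed
qed

text \<open>The space is cut by \<open>C n\<close>, then by integer bounds \<open>K\<close> on the
  sum of norms, then by labellings. On \<open>D n K\<close> the mesh \<delta> and the net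
  \<open>V\<close> are deterministic and the labellings finite in number, so countably many pieces
  suffice.\<close>

lemma nearly_fixed_space:
  assumes \<epsilon>: "0 < \<epsilon>"
  shows "nearly_fixed \<epsilon> (space M)"
proof -
  obtain x :: "nat \<Rightarrow> 'e" and C where x: "\<forall>n. x n \<in> G" and C: "\<forall>n. C n \<in> sets M" and cover: "AE \<omega> in M. \<exists>n. \<omega> \<in> C n"
    and near: "\<forall>n. \<forall>y\<in>G. AE \<omega> in M. \<omega> \<in> C n \<longrightarrow> (\<exists>i<n. rdist y (x i) \<omega> < \<epsilon>)"
    by (rule random_total_boundedness[OF \<epsilon>])
  have [measurable]: "rnorm (x i) \<in> borel_measurable M" "C n \<in> sets M" for i n using x C by auto
  define D where "D n K = {\<omega> \<in> C n. (\<Sum>i<n. rnorm (x i) \<omega>) \<le> real K}" for n K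
  have D: "D n K \<in> sets M" for n K
  proof -
    have "D n K = C n \<inter> {\<omega> \<in> space M. (\<Sum>i<n. rnorm (x i) \<omega>) \<le> real K}"
      using sets.sets_into_space[of "C n" M] by (auto simp: D_def)
    then show ?thesis by simp
  qed
  have nearD: "nearly_fixed \<epsilon> (D n K)" for n K
  \<comment> \<open>No index lies below 0, so \<open>C 0\<close> is null; the simplex argument
    requires \<open>n\<close> to be positive.\<close>
  proof (cases "n = 0")
    case True
    obtain a where "a \<in> G" using G_nonempty by blast
    with near have "AE \<omega> in M. \<omega> \<in> C 0 \<longrightarrow> (\<exists>i<0. rdist a (x i) \<omega> < \<epsilon>)" by blast
    then have "AE \<omega> in M. \<omega> \<in> D n K \<longrightarrow> (\<exists>i\<in>{}::nat set. \<omega> \<in> {})"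
      by eventually_elim (simp add: D_def True)
    then show ?thesis by (rule nearly_fixed_UN[rotated 3]) simp_all
  next
    case False
    \<comment> \<open>Makes \<delta> times the sum of norms at most \<epsilon> on
      \<open>D n K\<close>; adding 1 covers \<open>K = 0\<close>.\<close>
    define \<delta> where "\<delta> = \<epsilon> / (real K + 1)"
    have "0 < \<delta>" using \<epsilon> by (simp add: \<delta>_def)
    have \<delta>K: "\<delta> * s \<le> \<epsilon>" if "s \<le> real K" for s
    proof -
      have "\<delta> * s \<le> \<delta> * (real K + 1)" using that \<open>0 < \<delta>\<close> by (intro mult_left_mono) auto
      then show ?thesis by (simp add: \<delta>_def)
    qed
    obtain V where V: "finite V" "V \<subseteq> std_simplex n"
      and lab: "\<And>j. j ` V \<subseteq> {..<n} \<Longrightarrow> \<exists>c\<in>std_simplex n. \<exists>t. (\<forall>v\<in>V. 0 \<le> t v) \<and> sum t V = 1 \<and>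
        (\<forall>i. c i = (\<Sum>v\<in>V. if j v = i then t v else 0)) \<and> (\<forall>v\<in>V. 0 < t v \<longrightarrow> (\<forall>i. \<bar>v i - c i\<bar> \<le> \<delta>))"
      using simplex_labelling[of n \<delta>] False \<open>0 < \<delta>\<close> by blast
    have TX: "T (comb n v x) \<in> G" if "v \<in> V" for v
      using that V(2) convex x by (intro T_closed comb_in_convex) (auto simp: std_simplex_def)
    define J where "J = PiE V (\<lambda>_. {..<n})"
    define B where "B j = {\<omega> \<in> D n K. \<forall>v\<in>V. rdist (T (comb n v x)) (x (j v)) \<omega> < \<epsilon>}" for j
    show ?thesis
    proof (rule nearly_fixed_UN[where I = J and B = B])
      show "countable J" unfolding J_def using V(1) by (intro countable_finite finite_PiE) auto
      show B: "B j \<in> sets M" for j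
      proof -
        have [measurable]: "rdist (T (comb n v x)) (x (j v)) \<in> borel_measurable M" if "v \<in> V" for v
          using TX[OF that] x by simp
        have "B j = D n K \<inter> {\<omega> \<in> space M. \<forall>v\<in>V. rdist (T (comb n v x)) (x (j v)) \<omega> < \<epsilon>}"
          using sets.sets_into_space[OF D] by (auto simp: B_def)
        also have "\<dots> \<in> sets M"
          using D V(1) by (intro sets.Int sets.sets_Collect_finite_All) auto
        finally show ?thesis .
      qed
      have "AE \<omega> in M. \<forall>v\<in>V. \<omega> \<in> C n \<longrightarrow> (\<exists>i<n. rdist (T (comb n v x)) (x i) \<omega> < \<epsilon>)"
        using near TX V(1) by (intro AE_ball_countable[THEN iffD2] ballI countable_finite) auto
      then show "AE \<omega> in M. \<omega> \<in> D n K \<longrightarrow> (\<exists>j\<in>J. \<omega> \<in> B j)"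
      proof eventually_elim
        case (elim \<omega>)
        show ?case
        proof
          assume \<omega>: "\<omega> \<in> D n K"
          then have "\<forall>v\<in>V. \<exists>i<n. rdist (T (comb n v x)) (x i) \<omega> < \<epsilon>"
            using elim by (simp add: D_def)
          then obtain j where "\<forall>v\<in>V. j v < n \<and> rdist (T (comb n v x)) (x (j v)) \<omega> < \<epsilon>"
            by metis
          with \<omega> show "\<exists>j\<in>J. \<omega> \<in> B j"
            \<comment> \<open>Restricting to \<open>V\<close> puts the labelling into the finite set
              \<open>J\<close> of extensional functions.\<close>
            by (intro bexI[of _ "restrict j V"]) (auto simp: J_def B_def)
        qed
      qed
      fix j assume "j \<in> J"
      then have j: "j ` V \<subseteq> {..<n}" by (auto simp: J_def)
      from lab[OF j] obtain c t where c: "c \<in> std_simplex n" and t: "\<forall>v\<in>V. 0 \<le> t v" "sum t V = 1"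
        and ct: "\<forall>i. c i = (\<Sum>v\<in>V. if j v = i then t v else 0)"
        and close: "\<forall>v\<in>V. 0 < t v \<longrightarrow> (\<forall>i. \<bar>v i - c i\<bar> \<le> \<delta>)"
        by blast
      show "nearly_fixed \<epsilon> (B j)"
      proof (rule nearly_fixed_labelled[where t = t and \<delta> = \<delta>, OF \<epsilon> spec[OF x] B V c spec[OF ct] j bspec[OF t(1)] t(2)])
        show "AE \<omega> in M. \<omega> \<in> B j \<longrightarrow> \<delta> * (\<Sum>i<n. rnorm (x i) \<omega>) \<le> \<epsilon>"
          by (intro AE_I2 impI \<delta>K) (simp add: B_def D_def)
        show "AE \<omega> in M. \<omega> \<in> B j \<longrightarrow> rdist (T (comb n v x)) (x (j v)) \<omega> < \<epsilon>" if "v \<in> V" for v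
          using that by (intro AE_I2) (simp add: B_def)
        show "\<bar>v i - c i\<bar> \<le> \<delta>" if "v \<in> V" "0 < t v" for v i
          using close that by blast
      qed
    qed
  qed
  show ?thesis
  proof (rule nearly_fixed_UN[where I = UNIV and B = "\<lambda>(n, K). D n K"])
    show "AE \<omega> in M. \<omega> \<in> space M \<longrightarrow> (\<exists>i\<in>UNIV. \<omega> \<in> (case i of (n, K) \<Rightarrow> D n K))"
      using cover
    proof eventually_elim
      case (elim \<omega>)
      then obtain n where "\<omega> \<in> C n" by blast
      moreover obtain K where "(\<Sum>i<n. rnorm (x i) \<omega>) \<le> real K" using real_arch_simple by blast
      ultimately show ?case by (auto simp: D_def)
    qed
  qed (use D nearD in auto)
qed

lemma fixed_point: "\<exists>z\<in>G. T z = z"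
proof -
  define Q where "Q k u w \<longleftrightarrow> u \<in> G \<and> w \<in> G \<and> (AE \<omega> in M. rdist u w \<omega> \<le> 1 / Suc k) \<and>
      (AE \<omega> in M. rdist u (T u) \<omega> \<le> 1 / Suc k + rdist (T u) (T w) \<omega>)" for k u w
  have "\<exists>u w. Q k u w" for k
  proof -
    obtain u w where "u \<in> G" "w \<in> G" and uw: "AE \<omega> in M. \<omega> \<in> space M \<longrightarrow> rdist u w \<omega> \<le> 1 / Suc k \<and>
        rdist u (T u) \<omega> \<le> 1 / Suc k + rdist (T u) (T w) \<omega>"
      using nearly_fixed_space[of "1 / Suc k"] unfolding nearly_fixed_def by auto
    moreover have "AE \<omega> in M. rdist u w \<omega> \<le> 1 / Suc k"
      using uw AE_space by eventually_elim simp
    moreover have "AE \<omega> in M. rdist u (T u) \<omega> \<le> 1 / Suc k + rdist (T u) (T w) \<omega>"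
      using uw AE_space by eventually_elim simp
    ultimately have "Q k u w" unfolding Q_def by blast
    then show ?thesis by blast
  qed
  then obtain u w where "\<And>k. Q k (u k) (w k)" by metis
  then have "\<And>k. u k \<in> G" "\<And>k. w k \<in> G" "\<And>k. AE \<omega> in M. rdist (u k) (w k) \<omega> \<le> 1 / Suc k"
    "\<And>k. AE \<omega> in M. rdist (u k) (T (u k)) \<omega> \<le> 1 / Suc k + rdist (T (u k)) (T (w k)) \<omega>"
    unfolding Q_def by blast+
  then show ?thesis by (rule fixed_point_of_approximation)
qed

end

theorem theorem1p12:
  fixes M :: "'w measure"
    and E :: "(('w \<Rightarrow> 'k::real_or_complex) set, 'e) module"
    and nrm :: "'e \<Rightarrow> ('w \<Rightarrow> real) set"
    and G :: "'e set"
    and T :: "'e \<Rightarrow> 'e"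
  assumes "RN_module M E nrm"
    and "random_seq_compact M E nrm G"
    and "L0_convex M E G"
    and "T \<in> G \<rightarrow> G"
    and "sigma_stable_map M E G E G T"
    and "random_seq_continuous M E nrm G E nrm G T"
  shows "\<exists>x\<in>G. T x = x"
proof -
  interpret RN_self_map M E nrm G T
    using assms by (intro RN_self_map.intro RN_self_map_axioms.intro)
  show ?thesis by (rule fixed_point)
qed

end
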